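(* Suppose $Q_{\mathrm{init}}\in C^2[0,1]$ is non-decreasing, $Q_{\mathrm{init}}(0)=0$, $Q_{\mathrm{init}}(1)=\Phi_F$, $$\frac{d}{d\eta}Q_{\mathrm{init}}(1)>K(\Phi_F),\qquad \frac{d}{d\eta}Q_{\mathrm{init}}(1)-\frac{d}{d\eta}Q_{\mathrm{init}}(0)=K(\Phi_F)-K(0),$$ and $$\frac{d^2}{d\eta^2}Q_{\mathrm{init}}(1)-\frac{d^2}{d\eta^2}Q_{\mathrm{init}}(0)=K'(\Phi_F)\frac{d}{d\eta}Q_{\mathrm{init}}(1)-K'(0)\frac{d}{d\eta}Q_{\mathrm{init}}(0).$$ Let $(Q,N)$ be the unique classical solution of system (S) with initial datum $Q_{\mathrm{init}}$ on its maximal existence interval $[0,\tau^* )$. Then $N\in C^1[0,\tau^* )$ and $Q\in C^2([0,\tau^* )\times[0,1])$.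
   Context: Standing assumptions: $\Phi_F>0$ is fixed and $K\in C^2(\mathbb{R})$ is a function with $K',K''$ bounded on $\mathbb{R}$ and $K(\phi)>0$ for $\phi\in[0,\Phi_F]$. System (S), for unknowns $Q(\tau,\eta)$ and $N(\tau)$: $$\partial_\tau Q+\partial_\eta Q=\frac1{N(\tau)}+K(Q)\quad(\tau>0,\ \eta\in(0,1)),\qquad Q(\tau,0)=0\quad(\tau>0),$$ $$\frac1{N(\tau)}=\partial_\eta Q(\tau,1)-K(\Phi_F)\quad(\tau>0),\qquad Q(0,\eta)=Q_{\mathrm{init}}(\eta)\quad(\eta\in[0,1]).$$ Classical solution: given $0<T\le+\infty$ and an initial datum $Q_{\mathrm{init}}\in C^1[0,1]$ that is increasing with $Q_{\mathrm{init}}(0)=0$, $Q_{\mathrm{init}}(1)=\Phi_F$ and $\frac{d}{d\eta}Q_{\mathrm{init}}(1)>K(\Phi_F)$, a pair $(Q,N)$ is a classical solution of (S) on $[0,T)$ if (1) $Q\in C^1([0,T)\times[0,1])$ is increasing in $\eta$ and $N\in C[0,T)$ is positive; (2) the equations of (S) hold in the classical sense for $\tau\in[0,T)$; (3) $K(\Phi_F)<\partial_\eta Q(\tau,1)<+\infty$ for all $\tau\in[0,T)$. Here "increasing" means non-decreasing. For initial data as in the claim there is a unique classical solution on a maximal interval $[0,\tau^* )$, $0<\tau^*\le+\infty$; the maximal existence time $\tau^*$ is the supremum of all $T$ for which a classical solution on $[0,T)$ exists. *)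

theory Defs
  imports "HOL-Analysis.Analysis"
begin

text \<open>The derivative is taken relative to the set \<open>S\<close>, so it is one-sided at the
  endpoints of an interval.\<close>

definition deriv_on :: "real set \<Rightarrow> (real \<Rightarrow> real) \<Rightarrow> real \<Rightarrow> real" where
  "deriv_on S f x = vector_derivative f (at x within S)"

primrec Ck_on :: "nat \<Rightarrow> real set \<Rightarrow> (real \<Rightarrow> real) \<Rightarrow> bool" where
  "Ck_on 0 S f \<longleftrightarrow> continuous_on S f"
| "Ck_on (Suc k) S f \<longleftrightarrow> f differentiable_on S \<and> Ck_on k S (deriv_on S f)"

definition partial1 :: "real set \<Rightarrow> (real \<Rightarrow> real \<Rightarrow> real) \<Rightarrow> real \<Rightarrow> real \<Rightarrow> real" where
  "partial1 I F t x = deriv_on I (\<lambda>s. F s x) t"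

definition partial2 :: "real set \<Rightarrow> (real \<Rightarrow> real \<Rightarrow> real) \<Rightarrow> real \<Rightarrow> real \<Rightarrow> real" where
  "partial2 J F t x = deriv_on J (\<lambda>y. F t y) x"

text \<open>\<open>C\<^sup>k(I \<times> J)\<close> for intervals \<open>I\<close>, \<open>J\<close>: all partial derivatives up to order \<open>k\<close>
  (in every order of differentiation, one-sided on the boundary) exist and are jointly
  continuous on \<open>I \<times> J\<close>.\<close>

primrec Ck_on_rect ::
    "nat \<Rightarrow> real set \<Rightarrow> real set \<Rightarrow> (real \<Rightarrow> real \<Rightarrow> real) \<Rightarrow> bool" where
  "Ck_on_rect 0 I J F \<longleftrightarrow> continuous_on (I \<times> J) (\<lambda>(t, x). F t x)"
| "Ck_on_rect (Suc k) I J F \<longleftrightarrow>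
     continuous_on (I \<times> J) (\<lambda>(t, x). F t x) \<and>
     (\<forall>x\<in>J. (\<lambda>s. F s x) differentiable_on I) \<and>
     (\<forall>t\<in>I. (\<lambda>y. F t y) differentiable_on J) \<and>
     Ck_on_rect k I J (partial1 I F) \<and>
     Ck_on_rect k I J (partial2 J F)"

text \<open>The interval \<open>[0,T)\<close> for \<open>0 < T \<le> \<infinity>\<close>.\<close>

definition time_interval :: "ereal \<Rightarrow> real set" where
  "time_interval T = {t. 0 \<le> t \<and> ereal t < T}"

definition initial_datum :: "(real \<Rightarrow> real) \<Rightarrow> real \<Rightarrow> (real \<Rightarrow> real) \<Rightarrow> bool" where
  "initial_datum K \<Phi>F Qinit \<longleftrightarrow>
     Ck_on 1 {0..1} Qinit \<and> mono_on {0..1} Qinit \<and>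
     Qinit 0 = 0 \<and> Qinit 1 = \<Phi>F \<and>
     deriv_on {0..1} Qinit 1 > K \<Phi>F"

definition solves_system ::
    "(real \<Rightarrow> real) \<Rightarrow> real \<Rightarrow> (real \<Rightarrow> real) \<Rightarrow> ereal \<Rightarrow>
     (real \<Rightarrow> real \<Rightarrow> real) \<Rightarrow> (real \<Rightarrow> real) \<Rightarrow> bool" where
  "solves_system K \<Phi>F Qinit T Q N \<longleftrightarrow>
     (\<forall>\<tau>\<in>time_interval T. \<tau> > 0 \<longrightarrow>
        (\<forall>\<eta>\<in>{0<..<1}.
           partial1 (time_interval T) Q \<tau> \<eta> + partial2 {0..1} Q \<tau> \<eta> =
             1 / N \<tau> + K (Q \<tau> \<eta>)) \<and>
        Q \<tau> 0 = 0 \<and>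
        1 / N \<tau> = partial2 {0..1} Q \<tau> 1 - K \<Phi>F) \<and>
     (\<forall>\<eta>\<in>{0..1}. Q 0 \<eta> = Qinit \<eta>)"

text \<open>The equations are imposed for \<open>\<tau> > 0\<close>; since \<open>Q\<close> is \<open>C\<^sup>1\<close> up to the boundary
  and \<open>N\<close> is continuous and positive, they then extend to \<open>\<tau> = 0\<close> (and the transport
  equation to \<open>\<eta> \<in> {0, 1}\<close>) by continuity. The bound \<open>\<partial>\<^sub>\<eta>Q(\<tau>,1) < \<infinity>\<close> is
  automatic for a real-valued derivative.\<close>

definition classical_solution ::
    "(real \<Rightarrow> real) \<Rightarrow> real \<Rightarrow> (real \<Rightarrow> real) \<Rightarrow> ereal \<Rightarrow>
     (real \<Rightarrow> real \<Rightarrow> real) \<Rightarrow> (real \<Rightarrow> real) \<Rightarrow> bool" where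
  "classical_solution K \<Phi>F Qinit T Q N \<longleftrightarrow>
     0 < T \<and> initial_datum K \<Phi>F Qinit \<and>
     Ck_on_rect 1 (time_interval T) {0..1} Q \<and>
     (\<forall>\<tau>\<in>time_interval T. mono_on {0..1} (Q \<tau>)) \<and>
     continuous_on (time_interval T) N \<and> (\<forall>\<tau>\<in>time_interval T. N \<tau> > 0) \<and>
     solves_system K \<Phi>F Qinit T Q N \<and>
     (\<forall>\<tau>\<in>time_interval T. K \<Phi>F < partial2 {0..1} Q \<tau> 1)"

definition max_existence_time ::
    "(real \<Rightarrow> real) \<Rightarrow> real \<Rightarrow> (real \<Rightarrow> real) \<Rightarrow> ereal" where
  "max_existence_time K \<Phi>F Qinit = Sup {T. \<exists>Q N. classical_solution K \<Phi>F Qinit T Q N}"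

end

theory Submission
  imports Defs
begin

text \<open>
  Write \<open>P = \<partial>\<^sub>\<eta>Q\<close>.  Formally \<open>P\<close> solves the linear transport equation
  \<open>P\<^sub>\<tau> + P\<^sub>\<eta> = K'(Q) P\<close>.  Since \<open>Q(\<tau>,0) = 0\<close>, the equation for \<open>Q\<close> at \<open>\<eta> = 0\<close> gives
  \<open>P(\<tau>,0) = 1/N(\<tau>) + K(0)\<close>, while \<open>1/N(\<tau>) = P(\<tau>,1) - K(\<Phi>\<^sub>F)\<close>; so what enters at \<open>\<eta> = 0\<close> is
  what leaves at \<open>\<eta> = 1\<close>, up to a constant: \<open>P(\<tau>,0) = P(\<tau>,1) - c\<close> with
  \<open>c = K(\<Phi>\<^sub>F) - K(0)\<close>.  The whole theorem reduces to \<open>P \<in> C\<^sup>1\<close>: then \<open>1/N = P(\<cdot>,1) - K(\<Phi>\<^sub>F)\<close>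
  is \<open>C\<^sup>1\<close>, and so is \<open>Q\<^sub>\<tau> = 1/N + K(Q) - P\<close>.

  The second derivatives of \<open>Q\<close> are not known to exist, so the equation for \<open>P\<close> is derived in
  integrated form: the equation for \<open>Q\<close> is integrated along a characteristic \<open>\<eta> - \<tau> = \<xi>\<close> and
  differentiated in \<open>\<eta>\<close> with the starting time fixed, which keeps the merely continuous
  \<open>1/N\<close> untouched (\<open>P_along_characteristic_integral\<close>).  Solving the resulting linear ODE yields
  \<open>P(\<tau>,\<eta>) = p(\<eta> - \<tau>) exp(G(\<eta> - \<tau>, \<tau>))\<close> (\<open>P_eq_p\<close>), where \<open>G\<close> is the integral of \<open>K'(Q)\<close> along
  the characteristic.  In order that \<open>G\<close> be \<open>C\<^sup>1\<close> across the diagonal \<open>\<eta> = \<tau>\<close>, which separates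
  the characteristics that start at \<open>\<tau> = 0\<close> from those that enter at \<open>\<eta> = 0\<close>, \<open>Q\<close> is first extended
  beyond \<open>0 \<le> \<eta> \<le> 1\<close> by its tangents and \<open>G\<close> always integrates from time \<open>0\<close>.

  It remains to see that the profile \<open>p\<close> is \<open>C\<^sup>1\<close>.  On \<open>[0,1]\<close> it is \<open>Q\<^sub>i\<^sub>n\<^sub>i\<^sub>t'\<close>.  For \<open>\<xi> \<le> 0\<close> the boundary
  law expresses \<open>p(\<xi>)\<close> through \<open>p(\<xi> + 1)\<close> and \<open>G\<close> (\<open>p_nonpos\<close>), so smoothness spreads to the
  left by one unit at a time (\<open>C1_on_p\<close>).  The only place where it could fail is \<open>\<xi> = 0\<close>,
  where \<open>p'(0-) = Q\<^sub>i\<^sub>n\<^sub>i\<^sub>t''(1) - K'(\<Phi>\<^sub>F) Q\<^sub>i\<^sub>n\<^sub>i\<^sub>t'(1) + K'(0) Q\<^sub>i\<^sub>n\<^sub>i\<^sub>t'(0)\<close>; the second-order compatibility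
  condition says exactly that this is \<open>Q\<^sub>i\<^sub>n\<^sub>i\<^sub>t''(0) = p'(0+)\<close> (\<open>p_left_derivative\<close>).
\<close>

section \<open>Continuously differentiable functions on a set\<close>

text \<open>The total derivative is taken within \<open>S\<close>, so one notion serves for intervals, for the space-time
  rectangle and for curves in it, and is stable under composition; the values of the derivative
  are operators so that their continuity can be expressed.\<close>
definition C1_on ::
    "'a::real_normed_vector set \<Rightarrow> ('a \<Rightarrow> 'b::real_normed_vector) \<Rightarrow> bool" where
  "C1_on S f \<longleftrightarrow>
     (\<exists>f'. (\<forall>x\<in>S. (f has_derivative blinfun_apply (f' x)) (at x within S)) \<and> continuous_on S f')"

lemma C1_onI:
  assumes "\<And>x. x \<in> S \<Longrightarrow> (f has_derivative blinfun_apply (f' x)) (at x within S)"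
    and "continuous_on S f'"
  shows "C1_on S f"
  using assms unfolding C1_on_def by blast

lemma C1_on_imp_continuous_on: "C1_on S f \<Longrightarrow> continuous_on S f"
  unfolding C1_on_def continuous_on_eq_continuous_within
  by (auto intro: has_derivative_continuous)

lemma C1_on_subset: "C1_on S f \<Longrightarrow> S' \<subseteq> S \<Longrightarrow> C1_on S' f"
  unfolding C1_on_def by (blast intro: continuous_on_subset has_derivative_subset)

lemma C1_on_cong:
  assumes "C1_on S f" "\<And>x. x \<in> S \<Longrightarrow> f x = g x"
  shows "C1_on S g"
proof -
  from assms(1) obtain f' where
    f: "\<And>x. x \<in> S \<Longrightarrow> (f has_derivative blinfun_apply (f' x)) (at x within S)" "continuous_on S f'"
    unfolding C1_on_def by blast
  show ?thesis
    by (rule C1_onI[OF has_derivative_transform[OF _ _ f(1)] f(2)]) (use assms(2) in auto)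
qed

lemma C1_on_compose:
  assumes "C1_on T g" "C1_on S f" "f ` S \<subseteq> T"
  shows "C1_on S (\<lambda>x. g (f x))"
proof -
  from assms obtain g' f' where
    g: "\<And>x. x \<in> T \<Longrightarrow> (g has_derivative blinfun_apply (g' x)) (at x within T)" "continuous_on T g'"
    and f: "\<And>x. x \<in> S \<Longrightarrow> (f has_derivative blinfun_apply (f' x)) (at x within S)" "continuous_on S f'"
    unfolding C1_on_def by blast
  have fc: "continuous_on S f" using assms(2) by (rule C1_on_imp_continuous_on)
  show ?thesis
  proof (rule C1_onI)
    fix x assume "x \<in> S"
    then show "((\<lambda>x. g (f x)) has_derivative blinfun_apply (g' (f x) o\<^sub>L f' x)) (at x within S)"
      using has_derivative_in_compose2[OF g(1) assms(3) _ f(1)] by (simp add: blinfun_compose.rep_eq o_def)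
  next
    show "continuous_on S (\<lambda>x. g' (f x) o\<^sub>L f' x)"
      by (intro bounded_bilinear.continuous_on[OF bounded_bilinear_blinfun_compose] f(2)
          continuous_on_compose2[OF g(2) fc assms(3)])
  qed
qed

lemma C1_on_const: "C1_on S (\<lambda>x. c)"
  by (rule C1_onI[where f' = "\<lambda>x. 0"]) (auto simp: zero_blinfun.rep_eq)

lemma C1_on_bounded_linear:
  assumes "bounded_linear f"
  shows "C1_on S f"
  by (rule C1_onI[where f' = "\<lambda>x. Blinfun f"])
     (auto simp: bounded_linear_Blinfun_apply assms bounded_linear_imp_has_derivative)

lemma C1_on_add:
  assumes "C1_on S f" "C1_on S g"
  shows "C1_on S (\<lambda>x. f x + g x)"
  using assms unfolding C1_on_def
  by (elim exE conjE, intro exI[of _ "\<lambda>x. _ x + _ x"])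
     (auto intro!: derivative_eq_intros continuous_intros simp: blinfun.bilinear_simps)

lemma C1_on_minus:
  assumes "C1_on S f"
  shows "C1_on S (\<lambda>x. - f x)"
  using assms unfolding C1_on_def
  by (elim exE conjE, intro exI[of _ "\<lambda>x. - _ x"])
     (auto intro!: derivative_eq_intros continuous_intros simp: blinfun.bilinear_simps)

lemma C1_on_diff:
  assumes "C1_on S f" "C1_on S g"
  shows "C1_on S (\<lambda>x. f x - g x)"
  using C1_on_add[OF assms(1) C1_on_minus[OF assms(2)]] by simp

lemma C1_on_Pair:
  assumes "C1_on S f" "C1_on S g"
  shows "C1_on S (\<lambda>x. (f x, g x))"
proof -
  have "C1_on S (\<lambda>x. (f x, 0 :: 'c) + (0 :: 'b, g x))"
    by (intro C1_on_add C1_on_compose[OF C1_on_bounded_linear[of "\<lambda>a. (a, 0)"] assms(1)]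
        C1_on_compose[OF C1_on_bounded_linear[of "\<lambda>b. (0, b)"] assms(2)])
       (auto intro!: bounded_linear_Pair bounded_linear_zero bounded_linear_ident)
  then show ?thesis by simp
qed

lemma C1_on_mult:
  fixes f g :: "'a::real_normed_vector \<Rightarrow> real"
  assumes "C1_on S f" "C1_on S g"
  shows "C1_on S (\<lambda>x. f x * g x)"
proof -
  from assms obtain g' f' where
    g: "\<And>x. x \<in> S \<Longrightarrow> (g has_derivative blinfun_apply (g' x)) (at x within S)" "continuous_on S g'"
    and f: "\<And>x. x \<in> S \<Longrightarrow> (f has_derivative blinfun_apply (f' x)) (at x within S)" "continuous_on S f'"
    unfolding C1_on_def by blast
  note cont = C1_on_imp_continuous_on[OF assms(1)] C1_on_imp_continuous_on[OF assms(2)]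
  show ?thesis
  proof (rule C1_onI)
    fix x assume "x \<in> S"
    then show "((\<lambda>x. f x * g x) has_derivative blinfun_apply (f x *\<^sub>R g' x + g x *\<^sub>R f' x)) (at x within S)"
      by (intro has_derivative_eq_rhs[OF has_derivative_mult[OF f(1) g(1)]])
         (auto simp: blinfun.bilinear_simps)
  qed (intro continuous_intros cont f g)
qed

lemma blinfun_apply_scaleR_id_blinfun: "blinfun_apply (c *\<^sub>R id_blinfun) = (*) (c :: real)"
  by (auto simp: scaleR_blinfun.rep_eq)

lemma C1_on_real_iff:
  fixes f :: "real \<Rightarrow> real"
  shows "C1_on S f \<longleftrightarrow>
    (\<exists>f'. (\<forall>x\<in>S. (f has_real_derivative f' x) (at x within S)) \<and> continuous_on S f')"
proof
  assume "C1_on S f"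
  then obtain f' where f: "\<And>x. x \<in> S \<Longrightarrow> (f has_derivative blinfun_apply (f' x)) (at x within S)"
    "continuous_on S f'" unfolding C1_on_def by blast
  have "blinfun_apply (f' x) h = blinfun_apply (f' x) 1 * h" for x h
    using blinfun.scaleR_right[of "f' x" h 1] by simp
  then have "blinfun_apply (f' x) = (*) (blinfun_apply (f' x) 1)" for x
    by blast
  then have "\<forall>x\<in>S. (f has_real_derivative blinfun_apply (f' x) 1) (at x within S)"
    unfolding has_field_derivative_def using f(1) by simp
  moreover have "continuous_on S (\<lambda>x. blinfun_apply (f' x) 1)"
    by (intro continuous_intros f)
  ultimately show "\<exists>f'. (\<forall>x\<in>S. (f has_real_derivative f' x) (at x within S)) \<and> continuous_on S f'"
    by (intro exI[of _ "\<lambda>x. blinfun_apply (f' x) 1"] conjI)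
next
  assume "\<exists>f'. (\<forall>x\<in>S. (f has_real_derivative f' x) (at x within S)) \<and> continuous_on S f'"
  then obtain f' where f: "\<And>x. x \<in> S \<Longrightarrow> (f has_real_derivative f' x) (at x within S)"
    "continuous_on S f'" by blast
  show "C1_on S f"
  proof (rule C1_onI[where f' = "\<lambda>x. f' x *\<^sub>R id_blinfun"])
    fix x assume "x \<in> S"
    from f(1)[OF this]
    show "(f has_derivative blinfun_apply (f' x *\<^sub>R id_blinfun)) (at x within S)"
      unfolding has_field_derivative_def blinfun_apply_scaleR_id_blinfun .
  qed (intro continuous_intros f)
qed

lemma C1_on_exp:
  fixes f :: "'a::real_normed_vector \<Rightarrow> real"
  assumes "C1_on S f"
  shows "C1_on S (\<lambda>x. exp (f x))"
proof (rule C1_on_compose[OF _ assms, where T = UNIV])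
  show "C1_on UNIV (exp :: real \<Rightarrow> real)"
    unfolding C1_on_real_iff by (intro exI[of _ exp] conjI ballI DERIV_exp continuous_intros)
qed simp

lemma C1_on_inverse:
  fixes f :: "'a::real_normed_vector \<Rightarrow> real"
  assumes "C1_on S f" "\<And>x. x \<in> S \<Longrightarrow> f x \<noteq> 0"
  shows "C1_on S (\<lambda>x. inverse (f x))"
proof (rule C1_on_compose[OF _ assms(1), where T = "- {0}"])
  show "C1_on (- {0}) (inverse :: real \<Rightarrow> real)"
    unfolding C1_on_real_iff
    by (intro exI[of _ "\<lambda>x. - (inverse x * inverse x)"] conjI ballI)
       (use DERIV_inverse[where 'a = real] in \<open>auto intro!: continuous_on_minus continuous_on_mult
          continuous_on_inverse continuous_on_id intro: has_field_derivative_at_within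
          simp: power2_eq_square\<close>)
qed (use assms(2) in auto)

text \<open>The second conclusion keeps the value of the total derivative, which is needed where derivatives
  from two sides are compared.\<close>
lemma C1_on_partialsI:
  fixes F :: "real \<Rightarrow> real \<Rightarrow> real"
  assumes t: "\<And>t x. t \<in> I \<Longrightarrow> x \<in> J \<Longrightarrow> ((\<lambda>s. F s x) has_real_derivative Ft t x) (at t within I)"
    and x: "\<And>t x. t \<in> I \<Longrightarrow> x \<in> J \<Longrightarrow> ((\<lambda>y. F t y) has_real_derivative Fx t x) (at x within J)"
    and ct: "continuous_on (I \<times> J) (\<lambda>(t, x). Ft t x)"
    and cx: "continuous_on (I \<times> J) (\<lambda>(t, x). Fx t x)"
    and J: "convex J"
  shows "C1_on (I \<times> J) (\<lambda>(t, x). F t x)"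
    and "\<And>t x. t \<in> I \<Longrightarrow> x \<in> J \<Longrightarrow>
      ((\<lambda>(t, x). F t x) has_derivative (\<lambda>(h, k). Ft t x * h + Fx t x * k)) (at (t, x) within I \<times> J)"
proof -
  define D :: "real \<times> real \<Rightarrow> (real \<times> real) \<Rightarrow>\<^sub>L real" where
    "D = (\<lambda>z. (case z of (t, x) \<Rightarrow> Ft t x) *\<^sub>R fst_blinfun + (case z of (t, x) \<Rightarrow> Fx t x) *\<^sub>R snd_blinfun)"
  show der: "((\<lambda>(t, x). F t x) has_derivative (\<lambda>(h, k). Ft t x * h + Fx t x * k)) (at (t, x) within I \<times> J)"
    if "t \<in> I" "x \<in> J" for t x
  proof -
    have "((\<lambda>(t, x). F t x) has_derivative
        (\<lambda>(tx, ty). Ft t x * tx + blinfun_apply (Fx t x *\<^sub>R id_blinfun) ty)) (at (t, x) within I \<times> J)"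
    proof (rule has_derivative_partialsI[where fy = "\<lambda>t x. Fx t x *\<^sub>R id_blinfun"])
      show "((\<lambda>s. F s x) has_derivative (*) (Ft t x)) (at t within I)"
        using t[OF that] unfolding has_field_derivative_def .
      show "((\<lambda>y. F s y) has_derivative blinfun_apply (Fx s y *\<^sub>R id_blinfun)) (at y within J)"
        if "s \<in> I" "y \<in> J" for s y
        using x[OF that] unfolding has_field_derivative_def blinfun_apply_scaleR_id_blinfun .
      have "continuous_on (I \<times> J) (\<lambda>z. (case z of (t, x) \<Rightarrow> Fx t x) *\<^sub>R (id_blinfun :: real \<Rightarrow>\<^sub>L real))"
        by (rule continuous_on_scaleR[OF cx continuous_on_const])
      then show "continuous (at (t, x) within I \<times> J) (\<lambda>(t, x). Fx t x *\<^sub>R (id_blinfun :: real \<Rightarrow>\<^sub>L real))"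
        using that by (auto simp: continuous_on_eq_continuous_within case_prod_unfold)
    qed (use that J in auto)
    then show ?thesis by (simp add: blinfun_apply_scaleR_id_blinfun)
  qed
  show "C1_on (I \<times> J) (\<lambda>(t, x). F t x)"
  proof (rule C1_onI[where f' = D])
    fix z assume "z \<in> I \<times> J"
    then obtain t x where z: "z = (t, x)" "t \<in> I" "x \<in> J" by auto
    show "((\<lambda>(t, x). F t x) has_derivative blinfun_apply (D z)) (at z within I \<times> J)"
      unfolding z(1) by (rule has_derivative_eq_rhs[OF der[OF z(2,3)]])
         (auto simp: D_def blinfun.bilinear_simps fun_eq_iff)
  qed (unfold D_def, intro continuous_on_add continuous_on_scaleR ct cx continuous_on_const)
qed

lemma C1_on_partialsE:
  fixes F :: "real \<Rightarrow> real \<Rightarrow> real"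
  assumes "C1_on (I \<times> J) (\<lambda>(t, x). F t x)"
  obtains Ft Fx where
    "\<And>t x. t \<in> I \<Longrightarrow> x \<in> J \<Longrightarrow> ((\<lambda>s. F s x) has_real_derivative Ft t x) (at t within I)"
    "\<And>t x. t \<in> I \<Longrightarrow> x \<in> J \<Longrightarrow> ((\<lambda>y. F t y) has_real_derivative Fx t x) (at x within J)"
    "continuous_on (I \<times> J) (\<lambda>(t, x). Ft t x)"
    "continuous_on (I \<times> J) (\<lambda>(t, x). Fx t x)"
proof -
  from assms obtain D where
    D: "\<And>z. z \<in> I \<times> J \<Longrightarrow> ((\<lambda>(t, x). F t x) has_derivative blinfun_apply (D z)) (at z within I \<times> J)"
    and cD: "continuous_on (I \<times> J) D" unfolding C1_on_def by blast
  show thesis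
  proof
    fix t x assume tx: "t \<in> I" "x \<in> J"
    have "((\<lambda>s. (\<lambda>(t, x). F t x) (s, x)) has_derivative (\<lambda>h. D (t, x) (h, 0))) (at t within I)"
      by (rule has_derivative_in_compose2[where g' = D and t = "I \<times> J", OF D])
         (use tx in \<open>auto intro!: derivative_eq_intros\<close>)
    moreover have "D (t, x) (h, 0) = D (t, x) (1, 0) * h" for h
      using blinfun.scaleR_right[of "D (t, x)" h "(1, 0)"] by simp
    then have "(\<lambda>h. D (t, x) (h, 0)) = (*) (D (t, x) (1, 0))"
      by blast
    ultimately show "((\<lambda>s. F s x) has_real_derivative D (t, x) (1, 0)) (at t within I)"
      unfolding has_field_derivative_def by simp
    have "((\<lambda>y. (\<lambda>(t, x). F t x) (t, y)) has_derivative (\<lambda>h. D (t, x) (0, h))) (at x within J)"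
      by (rule has_derivative_in_compose2[where g' = D and t = "I \<times> J", OF D])
         (use tx in \<open>auto intro!: derivative_eq_intros\<close>)
    moreover have "D (t, x) (0, h) = D (t, x) (0, 1) * h" for h
      using blinfun.scaleR_right[of "D (t, x)" h "(0, 1)"] by simp
    then have "(\<lambda>h. D (t, x) (0, h)) = (*) (D (t, x) (0, 1))"
      by blast
    ultimately show "((\<lambda>y. F t y) has_real_derivative D (t, x) (0, 1)) (at x within J)"
      unfolding has_field_derivative_def by simp
  next
    show "continuous_on (I \<times> J) (\<lambda>(t, x). D (t, x) (1, 0))"
      "continuous_on (I \<times> J) (\<lambda>(t, x). D (t, x) (0, 1))"
      unfolding case_prod_unfold prod.collapse by (intro continuous_intros cD)+
  qed
qed

lemma has_real_derivative_imp_deriv_on: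
  "(f has_real_derivative d) (at x within S) \<Longrightarrow> at x within S \<noteq> bot \<Longrightarrow> deriv_on S f x = d"
  unfolding deriv_on_def
  by (simp add: has_real_derivative_iff_has_vector_derivative vector_derivative_within)

lemma differentiable_on_deriv_on:
  "f differentiable_on S \<Longrightarrow> x \<in> S \<Longrightarrow> (f has_real_derivative deriv_on S f x) (at x within S)"
  unfolding differentiable_on_def deriv_on_def
  by (simp add: has_real_derivative_iff_has_vector_derivative vector_derivative_works)

lemma has_real_derivative_imp_differentiable_on:
  assumes "\<And>x. x \<in> S \<Longrightarrow> (f has_real_derivative f' x) (at x within S)"
  shows "f differentiable_on S"
  unfolding differentiable_on_def
  using assms by (auto simp: has_field_derivative_def intro: differentiableI)

lemma Ck_on_1_iff_C1_on:
  assumes "\<And>x. x \<in> S \<Longrightarrow> at x within S \<noteq> bot"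
  shows "Ck_on 1 S f \<longleftrightarrow> C1_on S f"
proof
  assume "Ck_on 1 S f"
  then show "C1_on S f" unfolding C1_on_real_iff by (auto intro: differentiable_on_deriv_on)
next
  assume "C1_on S f"
  then obtain f' where f: "\<And>x. x \<in> S \<Longrightarrow> (f has_real_derivative f' x) (at x within S)"
    "continuous_on S f'" unfolding C1_on_real_iff by blast
  have "continuous_on S (deriv_on S f)"
    by (rule continuous_on_eq[OF f(2)]) (simp add: has_real_derivative_imp_deriv_on[OF f(1)] assms)
  then show "Ck_on 1 S f" using has_real_derivative_imp_differentiable_on[OF f(1)] by simp
qed

text \<open>Non-isolated points make the one-sided partial derivatives unique, hence equal to those chosen by
  \<^const>\<open>partial1\<close> and \<^const>\<open>partial2\<close>.\<close>
lemma Ck_on_rect_1_iff_C1_on: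
  assumes I: "\<And>x. x \<in> I \<Longrightarrow> at x within I \<noteq> bot" and J: "\<And>x. x \<in> J \<Longrightarrow> at x within J \<noteq> bot"
    and "convex J"
  shows "Ck_on_rect 1 I J F \<longleftrightarrow> C1_on (I \<times> J) (\<lambda>(t, x). F t x)"
proof
  assume F: "Ck_on_rect 1 I J F"
  show "C1_on (I \<times> J) (\<lambda>(t, x). F t x)"
    by (rule C1_on_partialsI(1)[where Ft = "partial1 I F" and Fx = "partial2 J F"])
       (use F \<open>convex J\<close> in \<open>auto simp: partial1_def partial2_def intro: differentiable_on_deriv_on\<close>)
next
  assume F: "C1_on (I \<times> J) (\<lambda>(t, x). F t x)"
  then obtain Ft Fx where *:
    "\<And>t x. t \<in> I \<Longrightarrow> x \<in> J \<Longrightarrow> ((\<lambda>s. F s x) has_real_derivative Ft t x) (at t within I)"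
    "\<And>t x. t \<in> I \<Longrightarrow> x \<in> J \<Longrightarrow> ((\<lambda>y. F t y) has_real_derivative Fx t x) (at x within J)"
    "continuous_on (I \<times> J) (\<lambda>(t, x). Ft t x)"
    "continuous_on (I \<times> J) (\<lambda>(t, x). Fx t x)"
    by (rule C1_on_partialsE) blast
  have "continuous_on (I \<times> J) (\<lambda>(t, x). partial1 I F t x)"
    by (rule continuous_on_eq[OF *(3)])
       (auto simp: partial1_def has_real_derivative_imp_deriv_on[OF *(1)] I)
  moreover have "continuous_on (I \<times> J) (\<lambda>(t, x). partial2 J F t x)"
    by (rule continuous_on_eq[OF *(4)])
       (auto simp: partial2_def has_real_derivative_imp_deriv_on[OF *(2)] J)
  ultimately show "Ck_on_rect 1 I J F"
    using C1_on_imp_continuous_on[OF F] has_real_derivative_imp_differentiable_on[OF *(1)]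
      has_real_derivative_imp_differentiable_on[OF *(2)] by simp
qed

text \<open>If \<open>x\<close> lies in only one of the two closed sets, the other one stays away from \<open>x\<close> and imposes no
  condition there.\<close>
lemma has_real_derivative_closed_Un:
  fixes f :: "real \<Rightarrow> real"
  assumes "closed S" "closed T" "x \<in> S \<union> T"
    and S: "x \<in> S \<Longrightarrow> (f has_real_derivative d) (at x within S)"
    and T: "x \<in> T \<Longrightarrow> (f has_real_derivative d) (at x within T)"
  shows "(f has_real_derivative d) (at x within S \<union> T)"
proof -
  have bot: "x \<notin> A \<Longrightarrow> closed A \<Longrightarrow> at x within A = bot" for A :: "real set"
    by (meson closed_limpt trivial_limit_within)
  have "((\<lambda>y. (f y - f x) / (y - x)) \<longlongrightarrow> d) (at x within S)"
    using S bot[of S] assms(1) unfolding has_field_derivative_iff by (cases "x \<in> S") auto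
  moreover have "((\<lambda>y. (f y - f x) / (y - x)) \<longlongrightarrow> d) (at x within T)"
    using T bot[of T] assms(2) unfolding has_field_derivative_iff by (cases "x \<in> T") auto
  ultimately show ?thesis unfolding has_field_derivative_iff by (simp add: Lim_within_Un)
qed

section \<open>Integrals along characteristics\<close>

definition clamp01 :: "real \<Rightarrow> real" where
  "clamp01 y = max 0 (min 1 y)"

lemma clamp01_mem: "clamp01 y \<in> {0..1}"
  unfolding clamp01_def by auto

lemma clamp01_id: "y \<in> {0..1} \<Longrightarrow> clamp01 y = y"
  unfolding clamp01_def by auto

lemma continuous_on_clamp01: "continuous_on S clamp01"
  unfolding clamp01_def by (intro continuous_intros)

lemma has_real_derivative_transform_on:
  assumes "(f has_real_derivative d) (at x within S)" "x \<in> S" "\<And>y. y \<in> S \<Longrightarrow> g y = f y"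
  shows "(g has_real_derivative d) (at x within S)"
  using has_derivative_transform[of x S g f "(*) d"] assms unfolding has_field_derivative_def by blast

text \<open>Outside \<open>[0,1]\<close> the extension follows the tangents at the endpoints, so its slope at any \<open>y\<close> is
  the slope of \<open>f\<close> at the nearest point of \<open>[0,1]\<close>.\<close>
lemma has_real_derivative_affine_extension:
  assumes f: "\<And>x. x \<in> {0..1} \<Longrightarrow> (f has_real_derivative f' x) (at x within {0..1})"
  shows "((\<lambda>y. f (clamp01 y) + (y - clamp01 y) * f' (clamp01 y)) has_real_derivative f' (clamp01 y)) (at y)"
    (is "(?g has_real_derivative _) _")
proof -
  have lower: "(?g has_real_derivative f' (clamp01 y)) (at y within {..0})" if "y \<in> {..0}"
  proof (rule has_real_derivative_transform_on[where f = "\<lambda>y. f 0 + y * f' 0"])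
    show "((\<lambda>y. f 0 + y * f' 0) has_real_derivative f' (clamp01 y)) (at y within {..0})"
      using that by (auto intro!: derivative_eq_intros simp: clamp01_def)
  qed (use that in \<open>auto simp: clamp01_def\<close>)
  have upper: "(?g has_real_derivative f' (clamp01 y)) (at y within {1..})" if "y \<in> {1..}"
  proof (rule has_real_derivative_transform_on[where f = "\<lambda>y. f 1 + (y - 1) * f' 1"])
    show "((\<lambda>y. f 1 + (y - 1) * f' 1) has_real_derivative f' (clamp01 y)) (at y within {1..})"
      using that by (auto intro!: derivative_eq_intros simp: clamp01_def)
  qed (use that in \<open>auto simp: clamp01_def\<close>)
  have middle: "(?g has_real_derivative f' (clamp01 y)) (at y within {0..1})" if "y \<in> {0..1}"
  proof (rule has_real_derivative_transform_on[where f = f])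
    show "(f has_real_derivative f' (clamp01 y)) (at y within {0..1})"
      using f that by (simp add: clamp01_id)
  qed (use that in \<open>auto simp: clamp01_def\<close>)
  have "(?g has_real_derivative f' (clamp01 y)) (at y within {..0} \<union> ({0..1} \<union> {1..}))"
    by (intro has_real_derivative_closed_Un lower middle upper) (auto)
  moreover have "{..0} \<union> ({0..1} \<union> {1..}) = (UNIV :: real set)" by auto
  ultimately show ?thesis by simp
qed

lemma integral_rescale_unit:
  fixes f :: "real \<Rightarrow> real"
  assumes "0 \<le> \<tau>" "continuous_on {0..\<tau>} f"
  shows "integral {0..\<tau>} f = integral {0..1} (\<lambda>u. \<tau> * f (\<tau> * u))"
proof (cases "\<tau> = 0")
  case False
  with assms have pos: "\<tau> > 0" by simp
  have "(f has_integral integral {0..\<tau>} f) {0..\<tau>}"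
    using assms(2) by (intro integrable_integral integrable_continuous_real)
  from has_integral_stretch_real[OF this False]
  have "((\<lambda>u. f (\<tau> * u)) has_integral (1 / \<tau>) * integral {0..\<tau>} f) ((\<lambda>x. x / \<tau>) ` {0..\<tau>})"
    using pos by simp
  moreover have "(\<lambda>x. x / \<tau>) ` {0..\<tau>} = {0..1}"
    using pos by (auto simp: image_divide_atLeastAtMost)
  ultimately have "((\<lambda>u. f (\<tau> * u)) has_integral (1 / \<tau>) * integral {0..\<tau>} f) {0..1}" by simp
  from has_integral_mult_right[OF this, of \<tau>]
  have "((\<lambda>u. \<tau> * f (\<tau> * u)) has_integral integral {0..\<tau>} f) {0..1}" using pos by simp
  then show ?thesis by (rule integral_unique[symmetric])
qed simp

text \<open>Rescaling the variable of integration to \<open>[0,1]\<close> moves the dependence on the upper limit into the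
  integrand, where continuity of parameter integrals applies.\<close>
lemma continuous_on_shear_integral:
  fixes g :: "real \<Rightarrow> real \<Rightarrow> real"
  assumes g: "continuous_on ({0..T} \<times> UNIV) (\<lambda>(s, y). g s y)"
  shows "continuous_on (UNIV \<times> {0..T}) (\<lambda>(\<xi>, \<tau>). integral {0..\<tau>} (\<lambda>s. g s (\<xi> + s)))"
proof -
  have "continuous_on (UNIV \<times> {0..T}) (\<lambda>z. integral (cbox 0 1) (\<lambda>u. snd z * g (snd z * u) (fst z + snd z * u)))"
  proof (rule integral_continuous_on_param)
    have "continuous_on ((UNIV \<times> {0..T}) \<times> cbox 0 1)
        (\<lambda>w. snd (fst w) * (\<lambda>(s, y). g s y) (snd (fst w) * snd w, fst (fst w) + snd (fst w) * snd w))"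
      by (intro continuous_intros continuous_on_compose2[OF g])
         (auto intro!: mult_nonneg_nonneg mult_left_le order_trans[OF mult_left_le])
    then show "continuous_on ((UNIV \<times> {0..T}) \<times> cbox 0 1)
        (\<lambda>(z, u). snd z * g (snd z * u) (fst z + snd z * u))"
      by (simp add: case_prod_unfold)
  qed
  then show ?thesis
  proof (rule continuous_on_eq)
    fix z :: "real \<times> real" assume "z \<in> UNIV \<times> {0..T}"
    then obtain \<xi> \<tau> where z: "z = (\<xi>, \<tau>)" "0 \<le> \<tau>" "\<tau> \<le> T" by (cases z) auto
    have "continuous_on {0..\<tau>} (\<lambda>s. (\<lambda>(s, y). g s y) (s, \<xi> + s))"
      by (rule continuous_on_compose2[OF g]) (use z in \<open>auto intro!: continuous_intros\<close>)
    with z show "integral (cbox 0 1) (\<lambda>u. snd z * g (snd z * u) (fst z + snd z * u)) =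
        (case z of (\<xi>, \<tau>) \<Rightarrow> integral {0..\<tau>} (\<lambda>s. g s (\<xi> + s)))"
      using integral_rescale_unit[of \<tau> "\<lambda>s. g s (\<xi> + s)"] by simp
  qed
qed

text \<open>The integral of \<open>g\<close> up to time \<open>\<tau>\<close> along the characteristic with label \<open>\<xi>\<close>.  Its derivative in
  \<open>\<tau>\<close> is the integrand at the end point; the derivative in \<open>\<xi>\<close> is taken under the integral.\<close>
lemma shear_integral_C1:
  fixes g g' :: "real \<Rightarrow> real \<Rightarrow> real"
  assumes g: "continuous_on ({0..T} \<times> UNIV) (\<lambda>(s, y). g s y)"
    and g': "continuous_on ({0..T} \<times> UNIV) (\<lambda>(s, y). g' s y)"
    and deriv: "\<And>s y. s \<in> {0..T} \<Longrightarrow> (g s has_real_derivative g' s y) (at y)"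
  defines "G \<equiv> \<lambda>\<xi> \<tau>. integral {0..\<tau>} (\<lambda>s. g s (\<xi> + s))"
  shows shear_integral_has_derivative_time:
      "\<And>\<xi> \<tau>. \<tau> \<in> {0..T} \<Longrightarrow> (G \<xi> has_real_derivative g \<tau> (\<xi> + \<tau>)) (at \<tau> within {0..T})"
    and C1_on_shear_integral: "C1_on (UNIV \<times> {0..T}) (\<lambda>(\<xi>, \<tau>). G \<xi> \<tau>)"
    and shear_integral_has_derivative: "\<And>\<xi> \<tau>. \<tau> \<in> {0..T} \<Longrightarrow>
      ((\<lambda>(\<xi>, \<tau>). G \<xi> \<tau>) has_derivative
        (\<lambda>(h, k). integral {0..\<tau>} (\<lambda>s. g' s (\<xi> + s)) * h + g \<tau> (\<xi> + \<tau>) * k))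
        (at (\<xi>, \<tau>) within UNIV \<times> {0..T})"
proof -
  have cont: "continuous_on {0..T} (\<lambda>s. g s (\<xi> + s))" for \<xi>
  proof -
    have "continuous_on {0..T} (\<lambda>s. (\<lambda>(s, y). g s y) (s, \<xi> + s))"
      by (rule continuous_on_compose2[OF g]) (auto intro!: continuous_intros)
    then show ?thesis by simp
  qed
  show time: "(G \<xi> has_real_derivative g \<tau> (\<xi> + \<tau>)) (at \<tau> within {0..T})"
    if "\<tau> \<in> {0..T}" for \<xi> \<tau>
    unfolding G_def by (rule integral_has_real_derivative[OF cont that])
  have label: "((\<lambda>\<xi>. G \<xi> \<tau>) has_real_derivative integral {0..\<tau>} (\<lambda>s. g' s (\<xi> + s))) (at \<xi> within UNIV)"
    if \<tau>: "\<tau> \<in> {0..T}" for \<xi> \<tau>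
  proof -
    have "((\<lambda>\<xi>. integral (cbox 0 \<tau>) (\<lambda>s. g s (\<xi> + s))) has_real_derivative
        integral (cbox 0 \<tau>) (\<lambda>s. g' s (\<xi> + s))) (at \<xi> within UNIV)"
    proof (rule leibniz_rule_field_derivative)
      fix \<xi> s :: real assume "s \<in> cbox 0 \<tau>"
      then have "(g s has_real_derivative g' s (\<xi> + s)) (at (\<xi> + s))" using deriv \<tau> by auto
      then have "((\<lambda>\<xi>. g s (\<xi> + s)) has_real_derivative g' s (\<xi> + s) * 1) (at \<xi> within UNIV)"
        by (rule DERIV_chain2[where g = "\<lambda>\<xi>. \<xi> + s"]) (auto intro!: derivative_eq_intros)
      then show "((\<lambda>\<xi>. g s (\<xi> + s)) has_real_derivative g' s (\<xi> + s)) (at \<xi> within UNIV)"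
        by simp
    next
      fix \<xi> :: real
      have "continuous_on {0..\<tau>} (\<lambda>s. g s (\<xi> + s))"
        by (rule continuous_on_subset[OF cont]) (use \<tau> in auto)
      then show "(\<lambda>s. g s (\<xi> + s)) integrable_on cbox 0 \<tau>"
        by (simp add: integrable_continuous_real)
    next
      have "continuous_on (UNIV \<times> cbox 0 \<tau>) (\<lambda>w. (\<lambda>(s, y). g' s y) (snd w, fst w + snd w))"
        by (rule continuous_on_compose2[OF g']) (use \<tau> in \<open>auto intro!: continuous_intros\<close>)
      then show "continuous_on (UNIV \<times> cbox 0 \<tau>) (\<lambda>(\<xi>, s). g' s (\<xi> + s))"
        by (simp add: case_prod_unfold)
    qed auto
    then show ?thesis by (simp add: G_def)
  qed
  have c1: "continuous_on (UNIV \<times> {0..T}) (\<lambda>(\<xi>, \<tau>). integral {0..\<tau>} (\<lambda>s. g' s (\<xi> + s)))"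
    by (rule continuous_on_shear_integral[OF g'])
  have "continuous_on (UNIV \<times> {0..T}) (\<lambda>w. (\<lambda>(s, y). g s y) (snd w, fst w + snd w))"
    by (rule continuous_on_compose2[OF g]) (auto intro!: continuous_intros)
  then have c2: "continuous_on (UNIV \<times> {0..T}) (\<lambda>(\<xi>, \<tau>). g \<tau> (\<xi> + \<tau>))"
    by (simp add: case_prod_unfold)
  show "C1_on (UNIV \<times> {0..T}) (\<lambda>(\<xi>, \<tau>). G \<xi> \<tau>)"
    by (rule C1_on_partialsI(1)[OF label time c1 c2]) auto
  show "((\<lambda>(\<xi>, \<tau>). G \<xi> \<tau>) has_derivative
        (\<lambda>(h, k). integral {0..\<tau>} (\<lambda>s. g' s (\<xi> + s)) * h + g \<tau> (\<xi> + \<tau>) * k))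
        (at (\<xi>, \<tau>) within UNIV \<times> {0..T})" if "\<tau> \<in> {0..T}" for \<xi> \<tau>
    by (rule C1_on_partialsI(2)[OF label time c1 c2]) (use that in auto)
qed

section \<open>Transport with re-entering outflow\<close>

lemma has_real_derivative_shift:
  fixes f :: "real \<Rightarrow> real"
  assumes "(f has_real_derivative d) (at (x + a) within T)" "(\<lambda>x. x + a) ` S \<subseteq> T"
  shows "((\<lambda>x. f (x + a)) has_real_derivative d) (at x within S)"
proof -
  have "((\<lambda>x. x + a) has_real_derivative 1) (at x within S)"
    by (auto intro!: derivative_eq_intros)
  from DERIV_image_chain[OF DERIV_subset[OF assms] this] show ?thesis by (simp add: o_def)
qed

text \<open>A \<open>C\<^sup>1\<close> solution \<open>Q\<close> of \<open>Q\<^sub>\<tau> + Q\<^sub>\<eta> = m(\<tau>) + K(Q)\<close> on \<open>[0,T] \<times> [0,1]\<close> whose slope \<open>P = Q\<^sub>\<eta>\<close> re-enters at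
  \<open>\<eta> = 0\<close> when it leaves at \<open>\<eta> = 1\<close>, diminished by the constant \<open>c\<close>.  The functions \<open>K1\<close>, \<open>K2\<close> are the
  derivatives of \<open>K\<close>, and \<open>P0'\<close> is the second derivative of the initial datum.  For \<open>P\<close> to be
  differentiable at the corner \<open>(0,0)\<close>, the law \<open>inflow\<close> must be compatible with the equation for \<open>P\<close>
  to first order: differentiating it at \<open>\<tau> = 0\<close> and inserting \<open>P\<^sub>\<tau> = K1(Q) P - P0'\<close> at both ends gives
  \<open>compat\<close>.\<close>
locale nonlocal_transport =
  fixes T c :: real and Q Q\<^sub>\<tau> P :: "real \<Rightarrow> real \<Rightarrow> real" and K K1 K2 m P0' :: "real \<Rightarrow> real"
  assumes T: "0 < T"
    and Q_tau: "\<And>\<tau> \<eta>. \<tau> \<in> {0..T} \<Longrightarrow> \<eta> \<in> {0..1} \<Longrightarrow>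
          ((\<lambda>s. Q s \<eta>) has_real_derivative Q\<^sub>\<tau> \<tau> \<eta>) (at \<tau> within {0..T})"
    and Q_eta: "\<And>\<tau> \<eta>. \<tau> \<in> {0..T} \<Longrightarrow> \<eta> \<in> {0..1} \<Longrightarrow>
          (Q \<tau> has_real_derivative P \<tau> \<eta>) (at \<eta> within {0..1})"
    and cont_Q_tau: "continuous_on ({0..T} \<times> {0..1}) (\<lambda>(\<tau>, \<eta>). Q\<^sub>\<tau> \<tau> \<eta>)"
    and cont_P: "continuous_on ({0..T} \<times> {0..1}) (\<lambda>(\<tau>, \<eta>). P \<tau> \<eta>)"
    and K: "\<And>x. (K has_real_derivative K1 x) (at x)"
    and K1: "\<And>x. (K1 has_real_derivative K2 x) (at x)"
    and cont_K2: "continuous_on UNIV K2"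
    and cont_m: "continuous_on {0..T} m"
    and transport: "\<And>\<tau> \<eta>. \<tau> \<in> {0..T} \<Longrightarrow> \<eta> \<in> {0..1} \<Longrightarrow>
          Q\<^sub>\<tau> \<tau> \<eta> + P \<tau> \<eta> = m \<tau> + K (Q \<tau> \<eta>)"
    and inflow: "\<And>\<tau>. \<tau> \<in> {0..T} \<Longrightarrow> P \<tau> 0 = P \<tau> 1 - c"
    and initial: "\<And>\<eta>. \<eta> \<in> {0..1} \<Longrightarrow> (P 0 has_real_derivative P0' \<eta>) (at \<eta> within {0..1})"
    and cont_P0': "continuous_on {0..1} P0'"
    and compat: "P0' 1 - P0' 0 = K1 (Q 0 1) * P 0 1 - K1 (Q 0 0) * P 0 0"
begin

lemma Q_has_derivative:
  assumes "\<tau> \<in> {0..T}" "\<eta> \<in> {0..1}"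
  shows "((\<lambda>(\<tau>, \<eta>). Q \<tau> \<eta>) has_derivative (\<lambda>(h, k). Q\<^sub>\<tau> \<tau> \<eta> * h + P \<tau> \<eta> * k))
    (at (\<tau>, \<eta>) within {0..T} \<times> {0..1})"
  by (rule C1_on_partialsI(2)[OF Q_tau Q_eta cont_Q_tau cont_P]) (use assms in auto)

lemma C1_on_Q: "C1_on ({0..T} \<times> {0..1}) (\<lambda>(\<tau>, \<eta>). Q \<tau> \<eta>)"
  by (rule C1_on_partialsI(1)[OF Q_tau Q_eta cont_Q_tau cont_P]) auto

lemma continuous_on_Q_comp:
  assumes "continuous_on S f" "continuous_on S g" "\<And>x. x \<in> S \<Longrightarrow> f x \<in> {0..T} \<and> g x \<in> {0..1}"
  shows "continuous_on S (\<lambda>x. Q (f x) (g x))"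
proof -
  have "(\<lambda>x. (f x, g x)) ` S \<subseteq> {0..T} \<times> {0..1}" using assms(3) by blast
  from continuous_on_compose2[OF C1_on_imp_continuous_on[OF C1_on_Q] continuous_on_Pair[OF assms(1,2)] this]
  show ?thesis by simp
qed

lemma continuous_on_P_comp:
  assumes "continuous_on S f" "continuous_on S g" "\<And>x. x \<in> S \<Longrightarrow> f x \<in> {0..T} \<and> g x \<in> {0..1}"
  shows "continuous_on S (\<lambda>x. P (f x) (g x))"
proof -
  have "(\<lambda>x. (f x, g x)) ` S \<subseteq> {0..T} \<times> {0..1}" using assms(3) by blast
  from continuous_on_compose2[OF cont_P continuous_on_Pair[OF assms(1,2)] this]
  show ?thesis by simp
qed

lemma continuous_on_K: "continuous_on S K" and continuous_on_K1: "continuous_on S K1"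
  by (intro continuous_at_imp_continuous_on ballI DERIV_isCont[OF K] DERIV_isCont[OF K1])+

text \<open>Continuing \<open>Q\<close> by zero to \<open>\<eta> < 0\<close> would produce a kink at \<open>\<eta> = 0\<close>; the tangents make the extension
  \<open>C\<^sup>1\<close> in \<open>y\<close>, which suffices for \<open>G\<close> below to be \<open>C\<^sup>1\<close>.\<close>
definition Q_ext :: "real \<Rightarrow> real \<Rightarrow> real" where
  "Q_ext s y = Q s (clamp01 y) + (y - clamp01 y) * P s (clamp01 y)"

text \<open>Inside the strip this is the growth rate of \<open>P\<close> along characteristics.\<close>
definition \<kappa> :: "real \<Rightarrow> real \<Rightarrow> real" where
  "\<kappa> s y = K1 (Q_ext s y)"

definition \<kappa>' :: "real \<Rightarrow> real \<Rightarrow> real" where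
  "\<kappa>' s y = K2 (Q_ext s y) * P s (clamp01 y)"

text \<open>For \<open>\<xi> < 0\<close> the characteristic enters the strip only at time \<open>-\<xi>\<close>; integrating from time \<open>0\<close> all
  the same, through the extended values, avoids a case distinction at \<open>\<xi> = 0\<close>.\<close>
definition G :: "real \<Rightarrow> real \<Rightarrow> real" where
  "G \<xi> \<tau> = integral {0..\<tau>} (\<lambda>s. \<kappa> s (\<xi> + s))"

lemma \<kappa>_inside: "y \<in> {0..1} \<Longrightarrow> \<kappa> s y = K1 (Q s y)"
  by (simp add: \<kappa>_def Q_ext_def clamp01_id)

lemma continuous_on_Q_ext: "continuous_on ({0..T} \<times> UNIV) (\<lambda>(s, y). Q_ext s y)"
  unfolding Q_ext_def case_prod_unfold
  by (intro continuous_intros continuous_on_Q_comp continuous_on_P_comp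
      continuous_on_compose2[OF continuous_on_clamp01[of UNIV]])
     (use clamp01_mem in auto)

lemma continuous_on_\<kappa>: "continuous_on ({0..T} \<times> UNIV) (\<lambda>(s, y). \<kappa> s y)"
  using continuous_on_compose2[OF continuous_on_K1[of UNIV] continuous_on_Q_ext]
  by (simp add: \<kappa>_def case_prod_unfold)

lemma continuous_on_\<kappa>': "continuous_on ({0..T} \<times> UNIV) (\<lambda>(s, y). \<kappa>' s y)"
proof -
  have "continuous_on ({0..T} \<times> UNIV) (\<lambda>z. K2 (Q_ext (fst z) (snd z)))"
    using continuous_on_compose2[OF cont_K2 continuous_on_Q_ext]
    by (simp add: case_prod_unfold)
  moreover have "continuous_on ({0..T} \<times> UNIV) (\<lambda>z. P (fst z) (clamp01 (snd z)))"
    by (intro continuous_intros continuous_on_P_comp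
        continuous_on_compose2[OF continuous_on_clamp01[of UNIV]])
       (use clamp01_mem in auto)
  ultimately show ?thesis
    unfolding \<kappa>'_def case_prod_unfold by (rule continuous_on_mult)
qed

lemma \<kappa>_has_derivative:
  assumes "s \<in> {0..T}"
  shows "(\<kappa> s has_real_derivative \<kappa>' s y) (at y)"
proof -
  have "(Q_ext s has_real_derivative P s (clamp01 y)) (at y)"
    using has_real_derivative_affine_extension[OF Q_eta[OF assms]] unfolding Q_ext_def .
  from DERIV_chain2[OF K1 this] show ?thesis unfolding \<kappa>_def \<kappa>'_def .
qed

lemma G_has_derivative_time:
  "\<tau> \<in> {0..T} \<Longrightarrow> (G \<xi> has_real_derivative \<kappa> \<tau> (\<xi> + \<tau>)) (at \<tau> within {0..T})"
  using shear_integral_has_derivative_time[OF continuous_on_\<kappa> continuous_on_\<kappa>' \<kappa>_has_derivative]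
  unfolding G_def by blast

lemma C1_on_G: "C1_on (UNIV \<times> {0..T}) (\<lambda>(\<xi>, \<tau>). G \<xi> \<tau>)"
  using C1_on_shear_integral[OF continuous_on_\<kappa> continuous_on_\<kappa>' \<kappa>_has_derivative]
  unfolding G_def by blast

lemma G_has_derivative_initial:
  "((\<lambda>(\<xi>, \<tau>). G \<xi> \<tau>) has_derivative (\<lambda>(h, k). \<kappa> 0 \<xi> * k)) (at (\<xi>, 0) within UNIV \<times> {0..T})"
  using shear_integral_has_derivative[OF continuous_on_\<kappa> continuous_on_\<kappa>' \<kappa>_has_derivative, of 0 \<xi>] T
  unfolding G_def by simp

lemma C1_on_G_comp:
  assumes "C1_on S f" "C1_on S g" "\<And>x. x \<in> S \<Longrightarrow> g x \<in> {0..T}"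
  shows "C1_on S (\<lambda>x. G (f x) (g x))"
proof -
  have "(\<lambda>x. (f x, g x)) ` S \<subseteq> UNIV \<times> {0..T}" using assms(3) by blast
  from C1_on_compose[OF C1_on_G C1_on_Pair[OF assms(1,2)] this] show ?thesis by simp
qed

lemma G_0 [simp]: "G \<xi> 0 = 0"
  by (simp add: G_def)

text \<open>Both end points of the piece of characteristic are moved in \<open>\<eta>\<close> at fixed times, so the term
  \<open>m\<close> drops out of the derivative.  The condition \<open>h < 1\<close> leaves a nondegenerate interval of
  starting points, on which derivatives are unique.\<close>
lemma P_along_characteristic_integral:
  assumes \<sigma>: "0 \<le> \<sigma>" "\<sigma> + h \<le> T" and h: "0 \<le> h" "h < 1" and z: "z \<in> {0..1 - h}"
  shows "P (\<sigma> + h) (z + h) = P \<sigma> z + integral {0..h} (\<lambda>r. K1 (Q (\<sigma> + r) (z + r)) * P (\<sigma> + r) (z + r))"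
proof -
  have Q_int: "Q (\<sigma> + h) (z + h) = Q \<sigma> z + integral {0..h} (\<lambda>r. m (\<sigma> + r) + K (Q (\<sigma> + r) (z + r)))"
    if z: "z \<in> {0..1 - h}" for z
  proof -
    have "((\<lambda>r. Q (\<sigma> + r) (z + r)) has_vector_derivative m (\<sigma> + r) + K (Q (\<sigma> + r) (z + r))) (at r within {0..h})"
      if r: "r \<in> {0..h}" for r
    proof -
      have line: "((\<lambda>r. (\<sigma> + r, z + r)) has_derivative (\<lambda>k. (k, k))) (at r within {0..h})"
        by (auto intro!: derivative_eq_intros)
      have "((\<lambda>(\<tau>, \<eta>). Q \<tau> \<eta>) has_derivative (\<lambda>(a, b). Q\<^sub>\<tau> (\<sigma> + r) (z + r) * a + P (\<sigma> + r) (z + r) * b))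
            (at (\<sigma> + r, z + r) within (\<lambda>r. (\<sigma> + r, z + r)) ` {0..h})"
        by (rule has_derivative_subset[OF Q_has_derivative]) (use r \<sigma> z in auto)
      from has_derivative_in_compose[OF line this, simplified]
      have "((\<lambda>r. Q (\<sigma> + r) (z + r)) has_real_derivative Q\<^sub>\<tau> (\<sigma> + r) (z + r) + P (\<sigma> + r) (z + r)) (at r within {0..h})"
        unfolding has_field_derivative_def by (rule has_derivative_eq_rhs[of "\<lambda>r. Q (\<sigma> + r) (z + r)"])
          (simp_all add: ring_distribs fun_eq_iff)
      then show ?thesis
        using transport[of "\<sigma> + r" "z + r"] r \<sigma> z
        by (auto simp: has_real_derivative_iff_has_vector_derivative)
    qed
    from fundamental_theorem_of_calculus[OF h(1) this] show ?thesis
      by (simp add: integral_unique)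
  qed
  have "((\<lambda>z. Q \<sigma> z + integral (cbox 0 h) (\<lambda>r. m (\<sigma> + r) + K (Q (\<sigma> + r) (z + r)))) has_real_derivative
      P \<sigma> z + integral (cbox 0 h) (\<lambda>r. K1 (Q (\<sigma> + r) (z + r)) * P (\<sigma> + r) (z + r))) (at z within {0..1 - h})"
  proof (rule DERIV_add)
    show "(Q \<sigma> has_real_derivative P \<sigma> z) (at z within {0..1 - h})"
      by (rule DERIV_subset[OF Q_eta]) (use \<sigma> h z in auto)
    show "((\<lambda>z. integral (cbox 0 h) (\<lambda>r. m (\<sigma> + r) + K (Q (\<sigma> + r) (z + r)))) has_real_derivative
      integral (cbox 0 h) (\<lambda>r. K1 (Q (\<sigma> + r) (z + r)) * P (\<sigma> + r) (z + r))) (at z within {0..1 - h})"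
    proof (rule leibniz_rule_field_derivative)
      fix z r assume zr: "z \<in> {0..1 - h}" "r \<in> cbox 0 h"
      have "((\<lambda>z. Q (\<sigma> + r) (z + r)) has_real_derivative P (\<sigma> + r) (z + r)) (at z within {0..1 - h})"
        by (rule has_real_derivative_shift[OF Q_eta]) (use zr \<sigma> in auto)
      from DERIV_chain2[OF K this]
      show "((\<lambda>z. m (\<sigma> + r) + K (Q (\<sigma> + r) (z + r))) has_real_derivative
          K1 (Q (\<sigma> + r) (z + r)) * P (\<sigma> + r) (z + r)) (at z within {0..1 - h})"
        by (auto intro!: derivative_eq_intros)
    next
      fix z assume z: "z \<in> {0..1 - h}"
      have "continuous_on {0..h} (\<lambda>r. m (\<sigma> + r) + K (Q (\<sigma> + r) (z + r)))"
        by (intro continuous_intros continuous_on_compose2[OF cont_m]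
            continuous_on_compose2[OF continuous_on_K[of UNIV]] continuous_on_Q_comp)
           (use z \<sigma> in auto)
      then show "(\<lambda>r. m (\<sigma> + r) + K (Q (\<sigma> + r) (z + r))) integrable_on cbox 0 h"
        by (simp add: integrable_continuous_real)
    next
      show "continuous_on ({0..1 - h} \<times> cbox 0 h) (\<lambda>(z, r). K1 (Q (\<sigma> + r) (z + r)) * P (\<sigma> + r) (z + r))"
        unfolding case_prod_unfold
        by (intro continuous_intros continuous_on_compose2[OF continuous_on_K1[of UNIV]]
            continuous_on_Q_comp continuous_on_P_comp)
           (use \<sigma> in auto)
    qed (use z in auto)
  qed
  then have rhs: "((\<lambda>z. Q (\<sigma> + h) (z + h)) has_real_derivative
      P \<sigma> z + integral {0..h} (\<lambda>r. K1 (Q (\<sigma> + r) (z + r)) * P (\<sigma> + r) (z + r))) (at z within {0..1 - h})"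
    unfolding box_real by (rule has_real_derivative_transform_on) (use z Q_int in auto)
  have lhs: "((\<lambda>z. Q (\<sigma> + h) (z + h)) has_real_derivative P (\<sigma> + h) (z + h)) (at z within {0..1 - h})"
    by (rule has_real_derivative_shift[OF Q_eta]) (use z h \<sigma> in auto)
  have "at z within {0..1 - h} \<noteq> bot"
    using z h by (simp add: trivial_limit_within islimpt_Icc)
  from has_field_derivative_unique[OF lhs rhs this] show ?thesis by simp
qed

text \<open>The point \<open>(max 0 (-\<xi>), max 0 \<xi>)\<close> is where the characteristic \<open>\<eta> - \<tau> = \<xi>\<close> enters the domain.
  The exponential carries the value of \<open>P\<close> there back to time \<open>0\<close>, to match the starting time of the
  integral \<open>G\<close>.\<close>
definition p :: "real \<Rightarrow> real" where
  "p \<xi> = P (max 0 (- \<xi>)) (max 0 \<xi>) * exp (- G \<xi> (max 0 (- \<xi>)))"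

text \<open>Along a characteristic \<open>P\<close> solves the linear equation with coefficient \<open>\<kappa>\<close>, whose integral is \<open>G\<close>; so
  \<open>P exp(-G)\<close> stays at its value at the entry point.\<close>
lemma P_eq_p:
  assumes \<tau>: "\<tau> \<in> {0..T}" and \<eta>: "\<eta> \<in> {0..1}"
  shows "P \<tau> \<eta> = p (\<eta> - \<tau>) * exp (G (\<eta> - \<tau>) \<tau>)"
proof -
  define \<xi> where "\<xi> = \<eta> - \<tau>"
  define \<sigma> where "\<sigma> = max 0 (- \<xi>)"
  define z where "z = max 0 \<xi>"
  define h where "h = \<tau> - \<sigma>"
  have *: "\<sigma> + h = \<tau>" "z + h = \<eta>" "\<xi> + \<sigma> = z" "0 \<le> h" "h \<le> 1" "0 \<le> \<sigma>" "0 \<le> z" "\<sigma> + h \<le> T" "z + h \<le> 1"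
    using assms unfolding \<xi>_def \<sigma>_def z_def h_def by auto
  define w where "w r = P (\<sigma> + r) (z + r) * exp (- G \<xi> (\<sigma> + r))" for r
  have "w h = w 0"
  proof (cases "h = 0")
    case False
    with * have "0 < h" by simp
    then show ?thesis
    proof (rule DERIV_isconst_end)
      have cont_G: "continuous_on {0..T} (G \<xi>)"
        by (rule DERIV_continuous_on[OF G_has_derivative_time])
      show "continuous_on {0..h} w"
        unfolding w_def
        by (intro continuous_intros continuous_on_P_comp continuous_on_compose2[OF cont_G]) (use * in auto)
    next
      fix r assume r: "0 < r" "r < h"
      \<comment> \<open>The integrated equation is available only up to times \<open>q < h\<close>, because \<open>h = 1\<close> may occur.\<close>
      define q where "q = (r + h) / 2"
      have q: "r < q" "q < h" using r by (auto simp: q_def)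
      let ?k = "\<lambda>r. K1 (Q (\<sigma> + r) (z + r)) * P (\<sigma> + r) (z + r)"
      have "((\<lambda>r. integral {0..r} ?k) has_real_derivative ?k r) (at r within {0..q})"
      proof (rule integral_has_real_derivative)
        show "continuous_on {0..q} ?k"
          by (intro continuous_intros continuous_on_compose2[OF continuous_on_K1[of UNIV]]
              continuous_on_Q_comp continuous_on_P_comp) (use * q in auto)
      qed (use r q in auto)
      then have "((\<lambda>r. P \<sigma> z + integral {0..r} ?k) has_real_derivative ?k r) (at r within {0..q})"
        by (auto intro!: derivative_eq_intros)
      then have "((\<lambda>r. P (\<sigma> + r) (z + r)) has_real_derivative ?k r) (at r within {0..q})"
      proof (rule has_real_derivative_transform_on)
        fix y assume "y \<in> {0..q}"
        then show "P (\<sigma> + y) (z + y) = P \<sigma> z + integral {0..y} ?k"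
          by (intro P_along_characteristic_integral) (use * q in auto)
      qed (use r q in auto)
      moreover have "at r within {0..q} = at r"
        using r q by (intro at_within_interior) auto
      ultimately have dP: "((\<lambda>r. P (\<sigma> + r) (z + r)) has_real_derivative ?k r) (at r)" by simp
      have "(G \<xi> has_real_derivative \<kappa> (\<sigma> + r) (\<xi> + (\<sigma> + r))) (at (\<sigma> + r) within {0..T})"
        by (rule G_has_derivative_time) (use * r in auto)
      moreover have "at (\<sigma> + r) within {0..T} = at (\<sigma> + r)"
        using r * by (intro at_within_interior) auto
      moreover have "\<kappa> (\<sigma> + r) (\<xi> + (\<sigma> + r)) = K1 (Q (\<sigma> + r) (z + r))"
      proof -
        have "\<xi> + (\<sigma> + r) = z + r" using *(3) by linarith
        moreover have "z + r \<in> {0..1}" using r * by auto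
        ultimately show ?thesis using \<kappa>_inside by metis
      qed
      ultimately have "(G \<xi> has_real_derivative K1 (Q (\<sigma> + r) (z + r))) (at (\<sigma> + r))" by simp
      then have dG: "((\<lambda>r. G \<xi> (\<sigma> + r)) has_real_derivative K1 (Q (\<sigma> + r) (z + r)) * 1) (at r)"
        by (rule DERIV_chain2) (auto intro!: derivative_eq_intros)
      show "(w has_real_derivative 0) (at r)"
        unfolding w_def
        by (rule DERIV_cong[OF DERIV_mult[OF dP DERIV_chain2[OF DERIV_exp DERIV_minus[OF dG]]]]) simp
    qed
  qed simp
  moreover have "w h = P \<tau> \<eta> * exp (- G \<xi> \<tau>)"
    unfolding w_def *(1,2) ..
  moreover have "w 0 = p \<xi>"
    by (simp add: w_def p_def \<sigma>_def z_def)
  ultimately have "p \<xi> * exp (G \<xi> \<tau>) = P \<tau> \<eta> * (exp (- G \<xi> \<tau>) * exp (G \<xi> \<tau>))" by simp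
  then show ?thesis by (simp add: \<xi>_def exp_minus)
qed

lemma p_nonneg: "\<xi> \<in> {0..1} \<Longrightarrow> p \<xi> = P 0 \<xi>"
  by (simp add: p_def)

text \<open>What enters at time \<open>-\<xi>\<close> left at \<open>\<eta> = 1\<close> at the same time, on the characteristic with label \<open>\<xi> + 1\<close>.\<close>
lemma p_nonpos:
  assumes "\<xi> \<in> {- T..0}"
  shows "p \<xi> = (p (\<xi> + 1) * exp (G (1 + \<xi>) (- \<xi>)) - c) * exp (- G \<xi> (- \<xi>))"
proof -
  have "p \<xi> = P (- \<xi>) 0 * exp (- G \<xi> (- \<xi>))" using assms by (simp add: p_def)
  also have "P (- \<xi>) 0 = P (- \<xi>) 1 - c" using assms by (intro inflow) auto
  also have "P (- \<xi>) 1 = p (\<xi> + 1) * exp (G (1 + \<xi>) (- \<xi>))"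
    using P_eq_p[of "- \<xi>" 1] assms by (simp add: add.commute)
  finally show ?thesis .
qed

lemma p_right_derivative:
  "\<xi> \<in> {0..1} \<Longrightarrow> (p has_real_derivative P0' \<xi>) (at \<xi> within {0..1})"
  by (rule has_real_derivative_transform_on[OF initial]) (auto simp: p_nonneg)

text \<open>For \<open>S \<le> 1\<close> the right-hand side of \<open>p_nonpos\<close> involves \<open>p\<close> only on \<open>[0,1]\<close>, where it is \<open>P 0\<close>; its
  derivative at \<open>0\<close> is therefore explicit, and \<open>compat\<close> identifies it with the derivative from the right.
  The derivative of \<open>G\<close> in \<open>\<xi>\<close> vanishes at time \<open>0\<close>.\<close>
lemma p_left_derivative:
  assumes "0 < S" "S \<le> 1" "S \<le> T"
  shows "(p has_real_derivative P0' 0) (at 0 within {- S..0})"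
proof -
  have G_line: "((\<lambda>\<xi>. G (a + \<xi>) (- \<xi>)) has_real_derivative - \<kappa> 0 a) (at 0 within {- S..0})" for a
  proof -
    have line: "((\<lambda>\<xi>. (a + \<xi>, - \<xi>)) has_derivative (\<lambda>k. (k, - k))) (at 0 within {- S..0})"
        by (auto intro!: derivative_eq_intros)
    have "((\<lambda>(\<xi>, \<tau>). G \<xi> \<tau>) has_derivative (\<lambda>(h, k). \<kappa> 0 a * k))
          (at (a + 0, - 0) within (\<lambda>\<xi>. (a + \<xi>, - \<xi>)) ` {- S..0})"
        by (rule has_derivative_subset[of _ _ _ "UNIV \<times> {0..T}"]) (use G_has_derivative_initial[of a] assms in auto)
    from has_derivative_in_compose[OF line this]
    have "((\<lambda>\<xi>. G (a + \<xi>) (- \<xi>)) has_derivative (\<lambda>k. - (\<kappa> 0 a * k))) (at 0 within {- S..0})"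
      by simp
    then show ?thesis
      unfolding has_field_derivative_def by (rule has_derivative_eq_rhs) (simp add: fun_eq_iff)
  qed
  have "((\<lambda>\<xi>. p (\<xi> + 1)) has_real_derivative P0' 1) (at 0 within {- S..0})"
    by (rule has_real_derivative_shift[where T = "{0..1}"]) (use p_right_derivative[of 1] assms in auto)
  note d = DERIV_mult[OF DERIV_diff[OF DERIV_mult[OF this DERIV_chain2[OF DERIV_exp G_line[of 1]]] DERIV_const[of c]]
      DERIV_chain2[OF DERIV_exp DERIV_minus[OF G_line[of 0]]]]
  have "P0' 1 - \<kappa> 0 1 * P 0 1 + (P 0 1 - c) * \<kappa> 0 0 = P0' 0"
    using compat inflow[of 0] T by (simp add: \<kappa>_inside algebra_simps)
  then have "((\<lambda>\<xi>. (p (\<xi> + 1) * exp (G (1 + \<xi>) (- \<xi>)) - c) * exp (- G (0 + \<xi>) (- \<xi>))) has_real_derivative P0' 0)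
      (at 0 within {- S..0})"
    by (intro DERIV_cong[OF d]) (simp add: p_nonneg algebra_simps)
  then show ?thesis
    by (rule has_real_derivative_transform_on) (use assms in \<open>auto simp: p_nonpos\<close>)
qed

text \<open>Induction on the length of the time interval: \<open>p_nonpos\<close> obtains \<open>p\<close> on \<open>[-S,0]\<close> from its values on
  \<open>[1-S,1]\<close>.\<close>
lemma C1_on_p: "S \<in> {0..T} \<Longrightarrow> S \<le> real n \<Longrightarrow> C1_on {- S..1} p"
proof (induction n arbitrary: S)
  case 0
  then have "S = 0" by simp
  moreover have "C1_on {0..1} p"
    unfolding C1_on_real_iff by (intro exI[of _ P0'] conjI ballI p_right_derivative cont_P0')
  ultimately show ?case by simp
next
  case (Suc n)
  show ?case
  proof (cases "S = 0")
    case True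
    then show ?thesis using Suc.IH[of 0] T by simp
  next
    case False
    with Suc.prems have S: "0 < S" "S \<le> T" "S \<le> real n + 1" by auto
    define R where "R = max 0 (S - 1)"
    have IH: "C1_on {- R..1} p"
      by (rule Suc.IH) (use S T in \<open>auto simp: R_def\<close>)
    have lin: "C1_on A (\<lambda>\<xi> :: real. a + \<xi>)" "C1_on A (\<lambda>\<xi> :: real. \<xi> + a)" "C1_on A (\<lambda>\<xi> :: real. - \<xi>)" for a A
      by (intro C1_on_add C1_on_minus C1_on_const C1_on_bounded_linear bounded_linear_ident)+
    have "C1_on {- S..0} (\<lambda>\<xi>. (p (\<xi> + 1) * exp (G (1 + \<xi>) (- \<xi>)) - c) * exp (- G (0 + \<xi>) (- \<xi>)))"
      by (intro C1_on_mult C1_on_diff C1_on_exp C1_on_minus[of _ "\<lambda>\<xi>. G (0 + \<xi>) (- \<xi>)"] C1_on_const C1_on_G_comp lin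
          C1_on_compose[OF IH lin(2)]) (use S in \<open>auto simp: R_def\<close>)
    then have "C1_on {- S..0} p"
      by (rule C1_on_cong) (use S in \<open>auto simp: p_nonpos\<close>)
    then obtain f where f: "\<And>\<xi>. \<xi> \<in> {- S..0} \<Longrightarrow> (p has_real_derivative f \<xi>) (at \<xi> within {- S..0})"
      "continuous_on {- S..0} f" unfolding C1_on_real_iff by blast
    have f0: "f 0 = P0' 0"
    proof -
      define S' where "S' = min 1 S"
      have S': "0 < S'" "S' \<le> 1" "S' \<le> T" "S' \<le> S" using S by (auto simp: S'_def)
      have "(p has_real_derivative f 0) (at 0 within {- S'..0})"
        by (rule DERIV_subset[OF f(1)]) (use S' in auto)
      moreover have "at 0 within {- S'..0} \<noteq> bot"
        using S' by (simp add: trivial_limit_within islimpt_Icc)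
      ultimately show ?thesis
        using has_field_derivative_unique[OF _ p_left_derivative[OF S'(1-3)]] by simp
    qed
    define D where "D \<xi> = (if \<xi> \<le> 0 then f \<xi> else P0' \<xi>)" for \<xi>
    have "(p has_real_derivative D \<xi>) (at \<xi> within {- S..0} \<union> {0..1})" if "\<xi> \<in> {- S..0} \<union> {0..1}" for \<xi>
    proof (rule has_real_derivative_closed_Un[OF _ _ that])
      show "(p has_real_derivative D \<xi>) (at \<xi> within {- S..0})" if "\<xi> \<in> {- S..0}"
        using f(1)[OF that] that by (simp add: D_def)
      show "(p has_real_derivative D \<xi>) (at \<xi> within {0..1})" if "\<xi> \<in> {0..1}"
        using p_right_derivative[OF that] that f0 by (cases "\<xi> = 0") (auto simp: D_def)
    qed auto
    moreover have "continuous_on ({- S..0} \<union> {0..1}) D"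
    proof (rule continuous_on_closed_Un)
      show "continuous_on {- S..0} D" by (rule continuous_on_eq[OF f(2)]) (simp add: D_def)
      show "continuous_on {0..1} D" by (rule continuous_on_eq[OF cont_P0']) (use f0 in \<open>auto simp: D_def\<close>)
    qed auto
    moreover have "{- S..0} \<union> {0..1} = {- S..1}" using S by auto
    ultimately show ?thesis unfolding C1_on_real_iff by (intro exI[of _ D]) simp
  qed
qed

lemma C1_on_P: "C1_on ({0..T} \<times> {0..1}) (\<lambda>(\<tau>, \<eta>). P \<tau> \<eta>)"
proof -
  obtain n where "T \<le> real n" using real_arch_simple by blast
  with T have p: "C1_on {- T..1} p" by (intro C1_on_p) auto
  have lin: "C1_on A (\<lambda>z :: real \<times> real. snd z - fst z)" "C1_on A (\<lambda>z :: real \<times> real. snd z)"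
      "C1_on A (\<lambda>z :: real \<times> real. fst z)" for A
    by (intro C1_on_diff C1_on_bounded_linear bounded_linear_fst bounded_linear_snd)+
  have "C1_on ({0..T} \<times> {0..1}) (\<lambda>z. p (snd z - fst z) * exp (G (snd z - fst z) (fst z)))"
    by (intro C1_on_mult C1_on_exp C1_on_G_comp lin C1_on_compose[OF p lin(1)]) auto
  then show ?thesis
    by (rule C1_on_cong) (auto simp: P_eq_p)
qed

end

section \<open>Regularity of the classical solution\<close>

lemma deriv_on_UNIV: "deriv_on UNIV f = deriv f"
  unfolding deriv_on_def field_derivative_eq_vector_derivative ..

text \<open>Partial derivatives relative to \<open>I\<close> and to \<open>I \<inter> U\<close> agree on \<open>I \<inter> U\<close> when \<open>U\<close> is open, and this canonical
  choice glues the local derivatives together.  It serves to pass from compact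
  intervals \<open>[0,T]\<close> to the half-open existence interval.\<close>
lemma C1_on_local:
  fixes F :: "real \<Rightarrow> real \<Rightarrow> real"
  assumes local: "\<And>t. t \<in> I \<Longrightarrow> \<exists>U. open U \<and> t \<in> U \<and> C1_on ((I \<inter> U) \<times> J) (\<lambda>(t, x). F t x)"
    and I: "\<And>t. t \<in> I \<Longrightarrow> at t within I \<noteq> bot" and J: "\<And>x. x \<in> J \<Longrightarrow> at x within J \<noteq> bot"
    and "convex J"
  shows "C1_on (I \<times> J) (\<lambda>(t, x). F t x)"
proof -
  have *: "((\<lambda>s. F s x) has_real_derivative partial1 I F t x) (at t within I) \<and>
      (F t has_real_derivative partial2 J F t x) (at x within J) \<and>
      continuous (at (t, x) within I \<times> J) (\<lambda>(t, x). partial1 I F t x) \<and>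
      continuous (at (t, x) within I \<times> J) (\<lambda>(t, x). partial2 J F t x)"
    if "t \<in> I" "x \<in> J" for t x
  proof -
    obtain U where U: "open U" "t \<in> U" "C1_on ((I \<inter> U) \<times> J) (\<lambda>(t, x). F t x)"
      using local[OF \<open>t \<in> I\<close>] by blast
    have within: "at s within I \<inter> U = at s within I" if "s \<in> I \<inter> U" for s
      by (rule at_within_nhd[of _ U]) (use that U in auto)
    have within2: "at (t, x) within (I \<inter> U) \<times> J = at (t, x) within I \<times> J"
      by (rule at_within_nhd[of _ "U \<times> UNIV"]) (use U in \<open>auto intro: open_Times\<close>)
    from U(3) obtain Ft Fx where F:
      "\<And>t x. t \<in> I \<inter> U \<Longrightarrow> x \<in> J \<Longrightarrow> ((\<lambda>s. F s x) has_real_derivative Ft t x) (at t within I \<inter> U)"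
      "\<And>t x. t \<in> I \<inter> U \<Longrightarrow> x \<in> J \<Longrightarrow> ((\<lambda>y. F t y) has_real_derivative Fx t x) (at x within J)"
      "continuous_on ((I \<inter> U) \<times> J) (\<lambda>(t, x). Ft t x)"
      "continuous_on ((I \<inter> U) \<times> J) (\<lambda>(t, x). Fx t x)"
      by (rule C1_on_partialsE) blast
    have p1: "partial1 I F s y = Ft s y" if "s \<in> I \<inter> U" "y \<in> J" for s y
      unfolding partial1_def
      using F(1)[OF that] within[OF that(1)] I that(1) by (intro has_real_derivative_imp_deriv_on) auto
    have p2: "partial2 J F s y = Fx s y" if "s \<in> I \<inter> U" "y \<in> J" for s y
      unfolding partial2_def
      using F(2)[OF that] J that by (intro has_real_derivative_imp_deriv_on) auto
    have tU: "t \<in> I \<inter> U" using that U by auto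
    have "continuous_on ((I \<inter> U) \<times> J) (\<lambda>(t, x). partial1 I F t x)"
      by (rule continuous_on_eq[OF F(3)]) (auto simp: p1)
    moreover have "continuous_on ((I \<inter> U) \<times> J) (\<lambda>(t, x). partial2 J F t x)"
      by (rule continuous_on_eq[OF F(4)]) (auto simp: p2)
    ultimately have "continuous (at (t, x) within I \<times> J) (\<lambda>(t, x). partial1 I F t x)"
      "continuous (at (t, x) within I \<times> J) (\<lambda>(t, x). partial2 J F t x)"
      unfolding within2[symmetric] using tU \<open>x \<in> J\<close> by (auto simp: continuous_on_eq_continuous_within)
    then show ?thesis
      using F(1)[OF tU \<open>x \<in> J\<close>] F(2)[OF tU \<open>x \<in> J\<close>] within[OF tU] p1[OF tU \<open>x \<in> J\<close>] p2[OF tU \<open>x \<in> J\<close>]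
      by simp
  qed
  show ?thesis
    by (rule C1_on_partialsI(1)[where Ft = "partial1 I F" and Fx = "partial2 J F"])
       (use * \<open>convex J\<close> in \<open>auto simp: continuous_on_eq_continuous_within\<close>)
qed

lemma continuous_zero_extends_to_rectangle:
  fixes f :: "real \<times> real \<Rightarrow> real"
  assumes "0 < T" "continuous_on ({0..T} \<times> {0..1}) f"
    and "\<And>z. z \<in> {0<..<T} \<times> {0<..<1} \<Longrightarrow> f z = 0" and "z \<in> {0..T} \<times> {0..1}"
  shows "f z = 0"
proof -
  have cl: "closure ({0<..<T} \<times> {0<..<1 :: real}) = {0..T} \<times> {0..1}"
    using assms(1) by (simp add: closure_Times)
  show ?thesis
    by (rule continuous_constant_on_closure[of "{0<..<T} \<times> {0<..<1}"]) (use assms cl in auto)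
qed

lemma continuous_zero_extends_to_Icc:
  fixes f :: "real \<Rightarrow> real"
  assumes "0 < T" "continuous_on {0..T} f" "\<And>t. t \<in> {0<..<T} \<Longrightarrow> f t = 0" "t \<in> {0..T}"
  shows "f t = 0"
proof -
  have cl: "closure {0<..<T} = {0..T}"
    using assms(1) by simp
  show ?thesis
    by (rule continuous_constant_on_closure[of "{0<..<T}"]) (use assms cl in auto)
qed

lemma at_within_unit_interval_neq_bot: "x \<in> {0..1 :: real} \<Longrightarrow> at x within {0..1} \<noteq> bot"
  by (simp add: trivial_limit_within islimpt_Icc)

lemma time_interval_downward_closed: "T \<in> time_interval \<tau>s \<Longrightarrow> {0..T} \<subseteq> time_interval \<tau>s"
  unfolding time_interval_def by (auto elim!: le_less_trans[rotated])

lemma time_interval_no_maximum: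
  assumes "t \<in> time_interval \<tau>s"
  obtains T where "T \<in> time_interval \<tau>s" "t < T" "0 < T"
proof -
  from assms have "0 \<le> t" "ereal t < \<tau>s" by (auto simp: time_interval_def)
  then obtain r where "ereal t < ereal r" "ereal r < \<tau>s" using ereal_dense2 by blast
  with \<open>0 \<le> t\<close> show thesis by (intro that[of r]) (auto simp: time_interval_def)
qed

lemma at_within_time_interval_neq_bot:
  assumes "t \<in> time_interval \<tau>s"
  shows "at t within time_interval \<tau>s \<noteq> bot"
proof -
  obtain T where T: "T \<in> time_interval \<tau>s" "t < T" "0 < T"
    using time_interval_no_maximum[OF assms] .
  have "0 \<le> t" using assms by (simp add: time_interval_def)
  with T have "at t within {0..T} \<noteq> bot" by (simp add: trivial_limit_within islimpt_Icc)
  then show ?thesis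
    using at_le[OF time_interval_downward_closed[OF T(1)], of t] by (auto simp: bot_unique)
qed

theorem theorem3p3:
  fixes K Qinit N :: "real \<Rightarrow> real" and \<Phi>F :: real
    and Q :: "real \<Rightarrow> real \<Rightarrow> real" and \<tau>s :: ereal
  assumes "\<Phi>F > 0"
    and "Ck_on 2 UNIV K"
    and "bounded (range (deriv K))"
    and "bounded (range (deriv (deriv K)))"
    and "\<forall>\<phi>\<in>{0..\<Phi>F}. K \<phi> > 0"
    and "Ck_on 2 {0..1} Qinit"
    and "mono_on {0..1} Qinit"
    and "Qinit 0 = 0"
    and "Qinit 1 = \<Phi>F"
    and "deriv_on {0..1} Qinit 1 > K \<Phi>F"
    and "deriv_on {0..1} Qinit 1 - deriv_on {0..1} Qinit 0 = K \<Phi>F - K 0"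
    and "deriv_on {0..1} (deriv_on {0..1} Qinit) 1 - deriv_on {0..1} (deriv_on {0..1} Qinit) 0
           = deriv K \<Phi>F * deriv_on {0..1} Qinit 1 - deriv K 0 * deriv_on {0..1} Qinit 0"
    and "\<tau>s = max_existence_time K \<Phi>F Qinit"
    and "classical_solution K \<Phi>F Qinit \<tau>s Q N"
  shows "Ck_on 1 (time_interval \<tau>s) N \<and> Ck_on_rect 2 (time_interval \<tau>s) {0..1} Q"
proof -
  define I where "I = time_interval \<tau>s"
  define P where "P = partial2 {0..1} Q"
  define Q\<^sub>\<tau> where "Q\<^sub>\<tau> = partial1 I Q"
  note sol = \<open>classical_solution K \<Phi>F Qinit \<tau>s Q N\<close>[unfolded classical_solution_def solves_system_def,
      folded I_def P_def, folded Q\<^sub>\<tau>_def]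
  have I_bot: "at t within I \<noteq> bot" if "t \<in> I" for t
    using at_within_time_interval_neq_bot that unfolding I_def .
  have I0: "0 \<in> I" using sol by (simp add: I_def time_interval_def zero_ereal_def)
  have I_sub: "{0..T} \<subseteq> I" if "T \<in> I" for T
    using time_interval_downward_closed that unfolding I_def .
  note J_bot = at_within_unit_interval_neq_bot

  have Q_rect: "Ck_on_rect 1 I {0..1} Q" using sol by blast
  then have C1_Q: "C1_on (I \<times> {0..1}) (\<lambda>(\<tau>, \<eta>). Q \<tau> \<eta>)"
    by (simp only: Ck_on_rect_1_iff_C1_on[OF I_bot J_bot convex_real_interval(5)])
  have dQ: "((\<lambda>s. Q s \<eta>) has_real_derivative Q\<^sub>\<tau> \<tau> \<eta>) (at \<tau> within I)"
      "(Q \<tau> has_real_derivative P \<tau> \<eta>) (at \<eta> within {0..1})" if "\<tau> \<in> I" "\<eta> \<in> {0..1}" for \<tau> \<eta>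
    using Q_rect that unfolding Q\<^sub>\<tau>_def P_def partial1_def partial2_def
    by (auto intro: differentiable_on_deriv_on)
  have cont_Q\<tau>: "continuous_on (I \<times> {0..1}) (\<lambda>(\<tau>, \<eta>). Q\<^sub>\<tau> \<tau> \<eta>)"
    and cont_P: "continuous_on (I \<times> {0..1}) (\<lambda>(\<tau>, \<eta>). P \<tau> \<eta>)"
    using Q_rect unfolding Q\<^sub>\<tau>_def P_def by simp_all
  note cont_Q = C1_on_imp_continuous_on[OF C1_Q]
  have N_pos: "N \<tau> > 0" if "\<tau> \<in> I" for \<tau> using sol that by blast
  have cont_N: "continuous_on I N" using sol by blast

  have K: "K differentiable_on UNIV" "deriv K differentiable_on UNIV" "continuous_on UNIV (deriv (deriv K))"
    using \<open>Ck_on 2 UNIV K\<close> by (simp_all add: numeral_2_eq_2 deriv_on_UNIV)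
  have dK: "(K has_real_derivative deriv K x) (at x)"
      "(deriv K has_real_derivative deriv (deriv K) x) (at x)" for x
    using differentiable_on_deriv_on[OF K(1)] differentiable_on_deriv_on[OF K(2)] by (simp_all add: deriv_on_UNIV)
  have C1_K: "C1_on UNIV K"
    unfolding C1_on_real_iff using dK differentiable_imp_continuous_on[OF K(2)] by (intro exI[of _ "deriv K"]) simp
  have cont_K: "continuous_on UNIV K" by (rule C1_on_imp_continuous_on[OF C1_K])

  have Q0: "Q 0 \<eta> = Qinit \<eta>" if "\<eta> \<in> {0..1}" for \<eta> using sol that by blast
  have Qinit: "Qinit differentiable_on {0..1}" "deriv_on {0..1} Qinit differentiable_on {0..1}"
      "continuous_on {0..1} (deriv_on {0..1} (deriv_on {0..1} Qinit))"
    using \<open>Ck_on 2 {0..1} Qinit\<close> by (simp_all add: numeral_2_eq_2)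
  have P0: "P 0 \<eta> = deriv_on {0..1} Qinit \<eta>" if "\<eta> \<in> {0..1}" for \<eta>
  proof -
    have "(Qinit has_real_derivative P 0 \<eta>) (at \<eta> within {0..1})"
      by (rule has_real_derivative_transform_on[OF dQ(2)[OF I0 that] that]) (simp add: Q0)
    from has_real_derivative_imp_deriv_on[OF this J_bot[OF that]] show ?thesis by simp
  qed

  have pde: "Q\<^sub>\<tau> \<tau> \<eta> + P \<tau> \<eta> = 1 / N \<tau> + K (Q \<tau> \<eta>)"
    if "\<tau> \<in> I" "0 < \<tau>" "\<eta> \<in> {0<..<1}" for \<tau> \<eta>
    using sol that by blast
  have bdry: "Q \<tau> 0 = 0" "1 / N \<tau> = P \<tau> 1 - K \<Phi>F" if "\<tau> \<in> I" "0 < \<tau>" for \<tau>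
    using sol that by blast+
  \<comment> \<open>By continuity the equations hold up to the boundary of the rectangle.\<close>
  have equations: "Q\<^sub>\<tau> \<tau> \<eta> + P \<tau> \<eta> = 1 / N \<tau> + K (Q \<tau> \<eta>)"
      "Q \<tau> 0 = 0" "1 / N \<tau> = P \<tau> 1 - K \<Phi>F" if "\<tau> \<in> I" "\<eta> \<in> {0..1}" for \<tau> \<eta>
  proof -
    obtain T where T: "T \<in> I" "\<tau> < T" "0 < T"
      using time_interval_no_maximum \<open>\<tau> \<in> I\<close> unfolding I_def by blast
    note sub = I_sub[OF T(1)]
    have \<tau>: "\<tau> \<in> {0..T}" using that T by (auto simp: I_def time_interval_def)
    have cN: "continuous_on {0..T} (\<lambda>s. 1 / N s)"
      using N_pos sub by (intro continuous_intros continuous_on_subset[OF cont_N sub]) force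
    have "continuous_on ({0..T} \<times> {0..1}) (\<lambda>z. (\<lambda>(\<tau>, \<eta>). Q\<^sub>\<tau> \<tau> \<eta>) z + (\<lambda>(\<tau>, \<eta>). P \<tau> \<eta>) z
        - (1 / N (fst z) + K ((\<lambda>(\<tau>, \<eta>). Q \<tau> \<eta>) z)))"
      by (intro continuous_on_add continuous_on_diff continuous_on_subset[OF cont_Q\<tau>] continuous_on_subset[OF cont_P]
          continuous_on_compose2[OF cN] continuous_on_compose2[OF cont_K] continuous_on_subset[OF cont_Q]
          continuous_on_fst continuous_on_id) (use sub in auto)
    from continuous_zero_extends_to_rectangle[OF T(3) this, of "(\<tau>, \<eta>)"]
    show "Q\<^sub>\<tau> \<tau> \<eta> + P \<tau> \<eta> = 1 / N \<tau> + K (Q \<tau> \<eta>)"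
      using pde sub that \<tau> by (auto simp: subset_iff)
    have "continuous_on {0..T} (\<lambda>s. 1 / N s - ((\<lambda>(\<tau>, \<eta>). P \<tau> \<eta>) (s, 1) - K \<Phi>F))"
      by (intro continuous_on_diff cN continuous_on_compose2[OF cont_P] continuous_on_const
          continuous_on_Pair continuous_on_id) (use sub in auto)
    from continuous_zero_extends_to_Icc[OF T(3) this, of \<tau>]
    show "1 / N \<tau> = P \<tau> 1 - K \<Phi>F" using bdry(2) sub \<tau> by (auto simp: subset_iff)
    show "Q \<tau> 0 = 0"
      using bdry(1)[OF \<open>\<tau> \<in> I\<close>] \<tau> Q0[of 0] \<open>Qinit 0 = 0\<close> by (cases "\<tau> = 0") auto
  qed

  \<comment> \<open>As \<open>Q(\<cdot>,0)\<close> vanishes, so does its time derivative; this gives the value of \<open>P\<close> at \<open>\<eta> = 0\<close>.\<close>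
  have inflow: "P \<tau> 0 = P \<tau> 1 - (K \<Phi>F - K 0)" if "\<tau> \<in> I" for \<tau>
  proof -
    have "((\<lambda>s. Q s 0) has_real_derivative 0) (at \<tau> within I)"
      by (rule has_real_derivative_transform_on[of "\<lambda>s. 0"]) (use that equations(2)[of _ 0] in auto)
    moreover have "((\<lambda>s. Q s 0) has_real_derivative Q\<^sub>\<tau> \<tau> 0) (at \<tau> within I)"
      by (rule dQ(1)) (use that in auto)
    ultimately have "Q\<^sub>\<tau> \<tau> 0 = 0" using has_field_derivative_unique I_bot[OF that] by blast
    with equations[OF that, of 0] show ?thesis by simp
  qed

  have C1_P_local: "C1_on ({0..T} \<times> {0..1}) (\<lambda>(\<tau>, \<eta>). P \<tau> \<eta>)" if T: "T \<in> I" "0 < T" for T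
  proof -
    note sub = I_sub[OF T(1)]
    have sub2: "{0..T} \<times> {0..1} \<subseteq> I \<times> {0..1}" using sub by blast
    interpret nonlocal_transport T "K \<Phi>F - K 0" Q Q\<^sub>\<tau> P K "deriv K" "deriv (deriv K)" "\<lambda>\<tau>. 1 / N \<tau>"
      "deriv_on {0..1} (deriv_on {0..1} Qinit)"
    proof
      show "((\<lambda>s. Q s \<eta>) has_real_derivative Q\<^sub>\<tau> \<tau> \<eta>) (at \<tau> within {0..T})"
        if "\<tau> \<in> {0..T}" "\<eta> \<in> {0..1}" for \<tau> \<eta>
        by (rule DERIV_subset[OF dQ(1) sub]) (use that sub in auto)
      show "(Q \<tau> has_real_derivative P \<tau> \<eta>) (at \<eta> within {0..1})"
        if "\<tau> \<in> {0..T}" "\<eta> \<in> {0..1}" for \<tau> \<eta>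
        by (rule dQ(2)) (use that sub in auto)
      show "continuous_on {0..T} (\<lambda>\<tau>. 1 / N \<tau>)"
        using N_pos sub by (intro continuous_intros continuous_on_subset[OF cont_N sub]) force
      show "Q\<^sub>\<tau> \<tau> \<eta> + P \<tau> \<eta> = 1 / N \<tau> + K (Q \<tau> \<eta>)" if "\<tau> \<in> {0..T}" "\<eta> \<in> {0..1}" for \<tau> \<eta>
        by (rule equations(1)) (use that sub in auto)
      show "P \<tau> 0 = P \<tau> 1 - (K \<Phi>F - K 0)" if "\<tau> \<in> {0..T}" for \<tau>
        by (rule inflow) (use that sub in auto)
      show "(P 0 has_real_derivative deriv_on {0..1} (deriv_on {0..1} Qinit) \<eta>) (at \<eta> within {0..1})"
        if "\<eta> \<in> {0..1}" for \<eta>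
        by (rule has_real_derivative_transform_on[OF differentiable_on_deriv_on[OF Qinit(2) that] that P0])
      show "deriv_on {0..1} (deriv_on {0..1} Qinit) 1 - deriv_on {0..1} (deriv_on {0..1} Qinit) 0 =
          deriv K (Q 0 1) * P 0 1 - deriv K (Q 0 0) * P 0 0"
        using assms(8,9,12) by (simp add: Q0 P0)
    qed (rule T(2) dK K(3) Qinit(3) continuous_on_subset[OF cont_Q\<tau> sub2] continuous_on_subset[OF cont_P sub2])+
    show ?thesis by (rule C1_on_P)
  qed
  have C1_P: "C1_on (I \<times> {0..1}) (\<lambda>(\<tau>, \<eta>). P \<tau> \<eta>)"
  proof (rule C1_on_local[OF _ I_bot J_bot convex_real_interval(5)])
    fix t assume "t \<in> I"
    then obtain T where T: "T \<in> I" "t < T" "0 < T"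
      using time_interval_no_maximum unfolding I_def by blast
    have "(I \<inter> {..<T}) \<times> {0..1} \<subseteq> {0..T} \<times> {0..1 :: real}"
      by (auto simp: I_def time_interval_def)
    from C1_on_subset[OF C1_P_local[OF T(1,3)] this] T(2)
    show "\<exists>U. open U \<and> t \<in> U \<and> C1_on ((I \<inter> U) \<times> {0..1}) (\<lambda>(\<tau>, \<eta>). P \<tau> \<eta>)"
      by (intro exI[of _ "{..<T}"]) auto
  qed

  have C1_b: "C1_on I (\<lambda>\<tau>. P \<tau> 1 - K \<Phi>F)"
  proof -
    have "C1_on I (\<lambda>\<tau>. (\<lambda>(\<tau>, \<eta>). P \<tau> \<eta>) (\<tau>, 1 :: real))"
      by (rule C1_on_compose[OF C1_P C1_on_Pair[OF C1_on_bounded_linear[OF bounded_linear_ident] C1_on_const]]) auto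
    from C1_on_diff[OF this C1_on_const] show ?thesis by simp
  qed
  have b_pos: "P \<tau> 1 - K \<Phi>F > 0" if "\<tau> \<in> I" for \<tau> using sol that by auto
  have "C1_on I N"
  proof (rule C1_on_cong[OF C1_on_inverse[OF C1_b]])
    show "inverse (P \<tau> 1 - K \<Phi>F) = N \<tau>" if "\<tau> \<in> I" for \<tau>
      unfolding equations(3)[OF that, of 0, simplified, symmetric] by simp
  qed (use b_pos in force)
  then have "Ck_on 1 I N" by (simp only: Ck_on_1_iff_C1_on[OF I_bot])

  moreover have "Ck_on_rect 2 I {0..1} Q"
  proof -
    have "C1_on (I \<times> {0..1}) (\<lambda>z. (P (fst z) 1 - K \<Phi>F) + K ((\<lambda>(\<tau>, \<eta>). Q \<tau> \<eta>) z) - (\<lambda>(\<tau>, \<eta>). P \<tau> \<eta>) z)"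
      by (intro C1_on_add C1_on_diff[OF _ C1_P] C1_on_compose[OF C1_b C1_on_bounded_linear[OF bounded_linear_fst]]
          C1_on_compose[OF C1_K C1_Q]) auto
    then have "C1_on (I \<times> {0..1}) (\<lambda>(\<tau>, \<eta>). Q\<^sub>\<tau> \<tau> \<eta>)"
    proof (rule C1_on_cong)
      fix z assume "z \<in> I \<times> {0..1 :: real}"
      then show "(P (fst z) 1 - K \<Phi>F) + K ((\<lambda>(\<tau>, \<eta>). Q \<tau> \<eta>) z) - (\<lambda>(\<tau>, \<eta>). P \<tau> \<eta>) z =
          (\<lambda>(\<tau>, \<eta>). Q\<^sub>\<tau> \<tau> \<eta>) z"
        using equations(1,3)[of "fst z" "snd z"] by (auto simp: case_prod_unfold)
    qed
    then have "Ck_on_rect 1 I {0..1} Q\<^sub>\<tau>"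
      by (simp only: Ck_on_rect_1_iff_C1_on[OF I_bot J_bot convex_real_interval(5)])
    moreover have "Ck_on_rect 1 I {0..1} P"
      using C1_P by (simp only: Ck_on_rect_1_iff_C1_on[OF I_bot J_bot convex_real_interval(5)])
    ultimately show ?thesis
      using Q_rect unfolding numeral_2_eq_2 One_nat_def Q\<^sub>\<tau>_def P_def by simp
  qed
  ultimately show ?thesis unfolding I_def by simp
qed

end
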